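(* Let $\epsilon\in\{-1,1\}$ and let $k\ge 1$ be an integer. Then $$M(a_n^{\epsilon}(k))=\frac{6}{\pi^2}\sum_{\lambda=(k_1^{n_{k_1}}\cdots k_s^{n_{k_s}})\in {\cal P}(k),\; n_{k_1}\ge \cdots \ge n_{k_s}\ge 1}\frac{\epsilon_2(\lambda)}{G(\lambda)\prod_{p\mid L(\lambda)/G(\lambda)}(p+1)},$$ (in particular the average on the left exists), where $L(\lambda)=\mathrm{lcm}(k_1,\dots,k_s)$, $G(\lambda)=\gcd(k_1,\dots,k_s)$, and the product is over primes $p$. Moreover, $M(\alpha_n(k))=M(a_n(k))=M(c_n(k))$ and $M(\beta_n(k))=0$.
   Context: Let $\Phi_n(x)$ be the $n$th cyclotomic polynomial; $a_n(k)$ is the coefficient of $x^k$ in $\Phi_n(x)$ (with $a_n(k)=0$ for $k>\varphi(n)$), and $c_n(k)$ is the coefficient of $x^k$ in the Taylor series of $1/\Phi_n(x)$ around $x=0$. For $\epsilon\in\{-1,1\}$, $a_n^{\epsilon}(k)$ denotes the $k$th Taylor coefficient around $x=0$ of $\prod_{d\mid n}(1-x^d)^{\epsilon\mu(n/d)}$, where $\mu$ is the Möbius function (so $a_n^1(k)=a_n(k)$ and $a_n^{-1}(k)=c_n(k)$ for $n>1$). Put $\alpha_n(k)=(a_n^1(k)+a_n^{-1}(k))/2$ and $\beta_n(k)=(a_n^1(k)-a_n^{-1}(k))/2$. For a function $f$ of $n$, $M(f(n))=\lim_{x\to\infty}\frac1x\sum_{n\le x}f(n)$. ${\cal P}(k)$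 is the set of partitions of $k$. A partition is written $\lambda=(k_1^{n_{k_1}}\cdots k_s^{n_{k_s}})$, meaning that the distinct parts are $k_1,\dots,k_s$ and $k_j$ occurs exactly $n_{k_j}$ times, ordered so that $n_{k_1}\ge\cdots\ge n_{k_s}\ge1$ (each partition is counted once; ties in the ordering are broken arbitrarily). Let $t$ be the largest index $\le s$ with $n_{k_t}\ge 2$ if $n_{k_1}\ge2$, and $t=0$ otherwise. With $L=\mathrm{lcm}(k_1,\dots,k_s)$ and $G=\gcd(k_1,\dots,k_s)$ define $$\epsilon_2(\lambda)=\epsilon_1(\lambda)\,\mu(L/k_{t+1})\cdots\mu(L/k_s)$$ (an empty product is $1$), where $\epsilon_1(\lambda)=1$ if $n_{k_1}=1$, $s$ is even and $\mu(L/G)\ne0$; $\epsilon_1(\lambda)=\mu(L/k_1)^{s-t}/2$ if $n_{k_1}\ge2$, $\mu(L/k_1)=\cdots=\mu(L/k_t)$ and $\mu(L/G)\neq0$; and $\epsilon_1(\lambda)=0$ otherwise. *)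

theory Defs
  imports
    "HOL-Library.Multiset"
    "HOL-Computational_Algebra.Squarefree"
    "HOL-Complex_Analysis.Complex_Analysis"
begin

definition moebius_mu :: "nat \<Rightarrow> int" where
  "moebius_mu n = (if squarefree n then (-1) ^ card (prime_factors n) else 0)"

definition cyclotomic_poly :: "nat \<Rightarrow> complex poly" where
  "cyclotomic_poly n =
     (\<Prod>j | j \<in> {1..n} \<and> coprime j n. [: - cis (2 * pi * real j / real n), 1 :])"

text \<open>
  The value of \<open>fps_nth (fps_expansion f 0) k\<close> is the \<open>k\<close>-th Taylor coefficient
  \<open>(deriv ^^ k) f 0 / fact k\<close>. All coefficients are taken as complex numbers.
\<close>

definition taylor_coeff0 :: "(complex \<Rightarrow> complex) \<Rightarrow> nat \<Rightarrow> complex" where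
  "taylor_coeff0 f k = fps_nth (fps_expansion f 0) k"

definition cyclo_a :: "nat \<Rightarrow> nat \<Rightarrow> complex" where
  "cyclo_a n k = coeff (cyclotomic_poly n) k"

definition cyclo_c :: "nat \<Rightarrow> nat \<Rightarrow> complex" where
  "cyclo_c n k = taylor_coeff0 (\<lambda>z. 1 / poly (cyclotomic_poly n) z) k"

definition cyclo_a_eps :: "int \<Rightarrow> nat \<Rightarrow> nat \<Rightarrow> complex" where
  "cyclo_a_eps \<epsilon> n k =
     taylor_coeff0 (\<lambda>z. \<Prod>d | d dvd n. (1 - z ^ d) powi (\<epsilon> * moebius_mu (n div d))) k"

definition cyclo_alpha :: "nat \<Rightarrow> nat \<Rightarrow> complex" where
  "cyclo_alpha n k = (cyclo_a_eps 1 n k + cyclo_a_eps (-1) n k) / 2"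

definition cyclo_beta :: "nat \<Rightarrow> nat \<Rightarrow> complex" where
  "cyclo_beta n k = (cyclo_a_eps 1 n k - cyclo_a_eps (-1) n k) / 2"

text \<open>The mean value of \<open>f\<close> over the positive integers exists and equals \<open>m\<close>.\<close>

definition has_mean_value :: "(nat \<Rightarrow> 'a :: real_normed_vector) \<Rightarrow> 'a \<Rightarrow> bool" where
  "has_mean_value f m \<longleftrightarrow>
     ((\<lambda>x :: real. (\<Sum>n | 1 \<le> n \<and> real n \<le> x. f n) /\<^sub>R x) \<longlongrightarrow> m) at_top"

definition int_partitions :: "nat \<Rightarrow> nat multiset set" where
  "int_partitions k = {\<Lambda>. 0 \<notin># \<Lambda> \<and> sum_mset \<Lambda> = k}"

text \<open>
  An admissible listing of the distinct parts of a partition: multiplicities are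
  weakly decreasing along the list. Parts of equal multiplicity may occur in any order.
\<close>

definition parts_listing :: "nat multiset \<Rightarrow> nat list \<Rightarrow> bool" where
  "parts_listing \<Lambda> ks \<longleftrightarrow>
     distinct ks \<and> set ks = set_mset \<Lambda> \<and> sorted_wrt (\<lambda>a b. count \<Lambda> a \<ge> count \<Lambda> b) ks"

definition part :: "nat list \<Rightarrow> nat \<Rightarrow> nat" where
  \<comment> \<open>1-based indexing\<close>
  "part ks j = ks ! (j - 1)"

definition L_part :: "nat multiset \<Rightarrow> nat" where
  "L_part \<Lambda> = Lcm (set_mset \<Lambda>)"

definition G_part :: "nat multiset \<Rightarrow> nat" where
  "G_part \<Lambda> = Gcd (set_mset \<Lambda>)"

definition t_index :: "nat multiset \<Rightarrow> nat list \<Rightarrow> nat" where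
  "t_index \<Lambda> ks =
     (if count \<Lambda> (part ks 1) \<ge> 2
      then Max {j \<in> {1..length ks}. count \<Lambda> (part ks j) \<ge> 2} else 0)"

definition eps1 :: "nat multiset \<Rightarrow> nat list \<Rightarrow> real" where
  "eps1 \<Lambda> ks =
     (let s = length ks; t = t_index \<Lambda> ks; L = L_part \<Lambda>; G = G_part \<Lambda> in
      if count \<Lambda> (part ks 1) = 1 \<and> even s \<and> moebius_mu (L div G) \<noteq> 0 then 1
      else if count \<Lambda> (part ks 1) \<ge> 2
           \<and> (\<forall>j \<in> {1..t}. moebius_mu (L div part ks j) = moebius_mu (L div part ks 1))
           \<and> moebius_mu (L div G) \<noteq> 0
        then real_of_int (moebius_mu (L div part ks 1)) ^ (s - t) / 2
      else 0)"

definition eps2 :: "nat multiset \<Rightarrow> nat list \<Rightarrow> real" where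
  "eps2 \<Lambda> ks =
     eps1 \<Lambda> ks *
     (\<Prod>j = t_index \<Lambda> ks + 1..length ks. real_of_int (moebius_mu (L_part \<Lambda> div part ks j)))"

text \<open>
  Partitions and listings are not degenerate: there are only finitely many
  partitions of \<open>k\<close>, and every partition has an admissible listing of its parts.
\<close>

lemma finite_int_partitions: "finite (int_partitions k)"
proof (rule finite_subset)
  show "int_partitions k \<subseteq> (\<Union>n\<le>k. multisets_of_size {..k} n)"
  proof
    fix \<Lambda> assume "\<Lambda> \<in> int_partitions k"
    then have pos: "\<forall>x \<in># \<Lambda>. 1 \<le> x" and sum: "sum_mset \<Lambda> = k"
      by (auto simp: int_partitions_def Suc_le_eq intro!: gr0I)
    have "size \<Lambda> \<le> sum_mset \<Lambda>"
      using pos by (induction \<Lambda>) auto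
    moreover have "set_mset \<Lambda> \<subseteq> {..k}"
      using sum by (auto dest: multi_member_split)
    ultimately show "\<Lambda> \<in> (\<Union>n\<le>k. multisets_of_size {..k} n)"
      using sum by (auto simp: multisets_of_size_def)
  qed
  show "finite (\<Union>n\<le>k. multisets_of_size {..k} n)"
    by auto
qed

lemma parts_listing_exists: "\<exists>ks. parts_listing \<Lambda> ks"
proof -
  define f where "f = (\<lambda>x. - int (count \<Lambda> x))"
  define ks where "ks = sort_key f (sorted_list_of_set (set_mset \<Lambda>))"
  have "sorted (map f ks)"
    by (simp add: ks_def)
  then have "sorted_wrt (\<lambda>a b. count \<Lambda> a \<ge> count \<Lambda> b) ks"
    by (simp add: sorted_map f_def)
  then show ?thesis
    by (auto simp: parts_listing_def ks_def intro!: exI[of _ ks])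
qed

end

theory Submission
  imports Defs
begin

text \<open>
  Expanding every factor of \<open>\<Prod> (1 - x\<^sup>d)\<^bsup>\<epsilon>\<mu>(n/d)\<^esup>\<close> as a power series writes \<open>a\<^sub>n\<^sup>\<epsilon>(k)\<close> as a
  sum over the partitions of \<open>k\<close>: the multiplicity of a part \<open>d\<close> records which power of
  \<open>x\<^sup>d\<close> is taken from the factor belonging to \<open>d\<close> (\<open>cyclo_a_eps_eq_partition_sum\<close>). There are
  finitely many partitions, so it suffices to average the contribution of each one over \<open>n\<close>.

  A partition with least common multiple \<open>L\<close> and greatest common divisor \<open>G\<close> of its parts
  contributes only at the multiples \<open>n = L m\<close>, and there only if every \<open>m L / d\<close> is squarefree,
  which means that \<open>L / G\<close> is squarefree and that \<open>m\<close> is squarefree and prime to it. For such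
  \<open>m\<close> we have \<open>\<mu>(m L / d) = \<mu>(m) \<mu>(L / d)\<close>, so the contribution depends only on the sign
  \<open>\<mu>(m)\<close> and is a linear combination of \<open>\<mu>(m)\<^sup>2\<close> and \<open>\<mu>(m)\<close>, both restricted to \<open>m\<close>
  prime to \<open>L / G\<close> (\<open>partition_term_multiple\<close>).

  The coefficient of \<open>\<mu>(m)\<^sup>2\<close> is the average of the contribution over the two signs, and this
  average is \<open>\<epsilon>\<^sub>2(\<lambda>)\<close> (\<open>sign_term_average\<close>). The mean value of the squarefree indicator away
  from the primes \<open>p\<close> dividing \<open>L / G\<close> is \<open>6/\<pi>\<^sup>2 \<Prod> p/(p+1)\<close>
  (\<open>has_mean_value_squarefree_away\<close>); since \<open>\<Prod> p = L / G\<close>, dividing by \<open>L\<close> gives the stated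
  weight. The sign \<open>\<epsilon>\<close> enters only through the term linear in \<open>\<mu>(m)\<close>, whose mean value is \<open>0\<close>
  (\<open>has_mean_value_moebius_away\<close>). This makes the means for \<open>\<epsilon> = 1\<close> and \<open>\<epsilon> = -1\<close> equal.

  The vanishing of the mean of \<open>\<mu>\<close> is equivalent to the prime number theorem and is the deep
  part. The series \<open>\<Sum> \<mu>(n) n\<^bsup>-1-z\<^esup>\<close> is \<open>1 / \<zeta>(1 + z)\<close>, which extends regularly to the closed
  half-plane \<open>Re z \<ge> 0\<close> because \<open>\<zeta>\<close> has no zero on its boundary (\<open>zeta_reg_nonzero\<close>), and it
  vanishes at \<open>z = 0\<close> because of the pole of \<open>\<zeta>\<close>. A Tauberian argument in the style of Newman
  (\<open>newman_tauberian\<close>) gives \<open>\<Sum> \<mu>(n)/n = 0\<close>, and partial summation does the rest.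
\<close>

section \<open>The Moebius function\<close>

lemma moebius_mu_1 [simp]: "moebius_mu 1 = 1" "moebius_mu (Suc 0) = 1"
  by (simp_all add: moebius_mu_def)

lemma moebius_mu_eq_0_iff: "moebius_mu n = 0 \<longleftrightarrow> \<not> squarefree n"
  by (simp add: moebius_mu_def)

lemma moebius_mu_cases: "moebius_mu n \<in> {-1, 0, 1}"
  by (simp add: moebius_mu_def minus_one_power_iff)

lemma moebius_mu_mult:
  assumes "coprime a b"
  shows "moebius_mu (a * b) = moebius_mu a * moebius_mu b"
proof (cases "squarefree a \<and> squarefree b")
  case True
  then have "a \<noteq> 0" "b \<noteq> 0"
    by (auto intro!: Nat.gr0I)
  moreover have "prime_factors a \<inter> prime_factors b = {}"
    using assms by (auto simp: in_prime_factors_iff dest: coprime_common_divisor)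
  ultimately show ?thesis
    using True assms
    by (simp add: moebius_mu_def squarefree_mult_coprime prime_factors_product card_Un_disjoint
        power_add)
next
  case False
  then have "\<not> squarefree (a * b)"
    using squarefree_multD by blast
  then show ?thesis
    using False by (auto simp: moebius_mu_def)
qed

lemma moebius_mu_prime: "prime p \<Longrightarrow> moebius_mu p = -1"
  by (simp add: moebius_mu_def squarefree_prime prime_factorization_prime)

lemma moebius_mu_prime_mult:
  "prime p \<Longrightarrow> \<not> p dvd n \<Longrightarrow> moebius_mu (p * n) = - moebius_mu n"
  by (simp add: moebius_mu_mult moebius_mu_prime prime_imp_coprime)

text \<open>Multiplication by a prime \<open>p\<close> dividing \<open>g\<close> pairs the divisors prime to \<open>p\<close> with
  divisors of opposite sign, and the divisors left over are divisible by \<open>p\<^sup>2\<close>.\<close>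

lemma sum_moebius_mu_divisors:
  assumes "g > 0"
  shows "(\<Sum>d | d dvd g. moebius_mu d) = (if g = 1 then 1 else 0)"
proof (cases "g = 1")
  case False
  then obtain p where p: "prime p" "p dvd g"
    using prime_factor_nat by blast
  define A where "A = {d. d dvd g \<and> \<not> p dvd d}"
  have fin: "finite {d. d dvd g}"
    using assms by simp
  have inj: "inj_on ((*) p) A"
    using p prime_gt_0_nat by (auto simp: inj_on_def)
  have finA: "finite A"
    unfolding A_def by (rule finite_subset[OF _ fin]) auto
  have sub: "A \<union> (*) p ` A \<subseteq> {d. d dvd g}"
    using p by (auto simp: A_def intro!: divides_mult prime_imp_coprime)
  have disj: "A \<inter> (*) p ` A = {}"
    by (auto simp: A_def)
  have "(\<Sum>d | d dvd g. moebius_mu d) = (\<Sum>d\<in>A \<union> (*) p ` A. moebius_mu d)"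
  proof (rule sum.mono_neutral_right[OF fin sub], rule ballI)
    fix d assume "d \<in> {d. d dvd g} - (A \<union> (*) p ` A)"
    then have d: "d dvd g" "d \<notin> A" "d \<notin> (*) p ` A"
      by auto
    then obtain e where e: "d = p * e"
      unfolding A_def by blast
    with d have "p dvd e"
      by (auto simp: A_def intro: dvd_mult_right)
    then have "p\<^sup>2 dvd d"
      by (simp add: e power2_eq_square)
    then have "\<not> squarefree d"
      using p squarefreeD not_prime_unit by blast
    then show "moebius_mu d = 0"
      by (simp add: moebius_mu_eq_0_iff)
  qed
  also have "\<dots> = (\<Sum>d\<in>A. moebius_mu d) + (\<Sum>d\<in>A. moebius_mu (p * d))"
    using finA disj by (simp add: sum.union_disjoint sum.reindex[OF inj])
  also have "(\<Sum>d\<in>A. moebius_mu (p * d)) = (\<Sum>d\<in>A. - moebius_mu d)"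
    using p by (intro sum.cong) (auto simp: A_def moebius_mu_prime_mult)
  finally show ?thesis
    using False by (simp add: sum_negf)
qed simp

section \<open>Euler products\<close>

lemma norm_nat_powr: "norm (of_nat n powr s :: complex) = real n powr Re s"
  by (simp add: norm_powr_real_powr)

lemma nat_powr_mult: "of_nat (m * n) powr s = of_nat m powr s * (of_nat n powr s :: complex)"
  by (simp add: powr_times_real)

lemma summable_norm_nat_powr:
  assumes "Re s > 1"
  shows "summable (\<lambda>n. norm (of_nat n powr -s :: complex))"
  using assms by (simp add: norm_nat_powr summable_real_powr_iff)

lemma summable_norm_bounded_nat_powr:
  fixes a :: "nat \<Rightarrow> complex"
  assumes "Re s > 1" "\<And>n. norm (a n) \<le> 1"
  shows "summable (\<lambda>n. norm (a n * of_nat n powr -s))"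
  by (rule summable_comparison_test'[OF summable_norm_nat_powr[OF assms(1)], of 0])
     (simp add: norm_mult assms(2) mult_left_le_one_le)

text \<open>
  The sieve form of the Euler product: multiplying a Dirichlet series by \<open>1 - q\<^sup>-\<^sup>s\<close>
  removes the multiples of \<open>q\<close>, because the removed terms are \<open>q\<^sup>-\<^sup>s\<close> times the series itself.
\<close>

lemma euler_product_sieve:
  assumes "finite P" "\<And>p. p \<in> P \<Longrightarrow> prime p" "Re s > 1"
  shows "(\<Prod>p\<in>P. 1 - of_nat p powr -s) * (\<Sum>n. of_nat n powr -s :: complex) =
         (\<Sum>n. of_bool (\<forall>p\<in>P. \<not> p dvd n) * of_nat n powr -s)"
  using assms(1,2)
proof (induction P rule: finite_induct)
  case (insert q P)
  define A where "A = (\<lambda>n. of_bool (\<forall>p\<in>P. \<not> p dvd n) :: complex)"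
  define A' where "A' = (\<lambda>n. of_bool (\<forall>p\<in>insert q P. \<not> p dvd n) :: complex)"
  have q: "prime q"
    using insert.prems by auto
  have summable: "summable (\<lambda>n. a n * of_nat n powr -s)"
    if "\<And>n. norm (a n) \<le> 1" for a :: "nat \<Rightarrow> complex"
    using summable_norm_bounded_nat_powr[OF assms(3) that] by (rule summable_norm_cancel)
  have A_q: "A (q * n) = A n" for n
  proof -
    have "p dvd q * n \<longleftrightarrow> p dvd n" if "p \<in> P" for p
    proof -
      have "prime p"
        using insert.prems that by auto
      moreover have "p \<noteq> q"
        using insert.hyps that by auto
      ultimately show ?thesis
        using q by (auto simp: prime_dvd_mult_iff dest: primes_dvd_imp_eq)
    qed
    then show ?thesis
      by (simp add: A_def)
  qed
  have "(\<Sum>n. A n * of_nat n powr -s) - (\<Sum>n. A' n * of_nat n powr -s)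
        = (\<Sum>n. A n * of_nat n powr -s - A' n * of_nat n powr -s)"
    by (intro suminf_diff summable) (auto simp: A_def A'_def)
  also have "\<dots> = (\<Sum>n. A (q * n) * of_nat (q * n) powr -s - A' (q * n) * of_nat (q * n) powr -s)"
    using q prime_gt_0_nat[of q]
    by (intro suminf_mono_reindex[symmetric]) (auto simp: strict_mono_def A_def A'_def)
  also have "\<dots> = (\<Sum>n. of_nat q powr -s * (A n * of_nat n powr -s))"
    by (subst A_q, subst nat_powr_mult) (simp add: A'_def mult_ac)
  also have "\<dots> = of_nat q powr -s * (\<Sum>n. A n * of_nat n powr -s)"
    by (intro suminf_mult summable) (auto simp: A_def)
  finally have "(1 - of_nat q powr -s) * (\<Sum>n. A n * of_nat n powr -s)
      = (\<Sum>n. A' n * of_nat n powr -s)"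
    by (simp add: algebra_simps)
  then show ?case
    using insert by (simp add: A_def A'_def mult.assoc)
qed simp

text \<open>Choosing \<open>-p\<^sup>-\<^sup>s\<close> from the factors of a subset of the primes contributes the squarefree
  product of that subset, with its Moebius sign.\<close>

lemma euler_product_moebius_finite:
  assumes "finite P" "\<And>p. p \<in> P \<Longrightarrow> prime p"
  shows "finite {n. squarefree n \<and> prime_factors n \<subseteq> P} \<and>
         (\<Prod>p\<in>P. 1 - of_nat p powr -s) =
         (\<Sum>n | squarefree n \<and> prime_factors n \<subseteq> P.
            of_int (moebius_mu n) * of_nat n powr -s :: complex)"
  using assms
proof (induction P rule: finite_induct)
  case empty
  have "{n. squarefree n \<and> prime_factors n \<subseteq> {}} = {1 :: nat}"
    by (auto simp: prime_factorization_empty_iff)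
  then show ?case
    by simp
next
  case (insert q P)
  define D where "D = (\<lambda>P. {n :: nat. squarefree n \<and> prime_factors n \<subseteq> P})"
  define f where "f = (\<lambda>n. of_int (moebius_mu n) * of_nat n powr -s :: complex)"
  have q: "prime q" "q > 0"
    using insert.prems by (auto simp: prime_gt_0_nat)
  have nq: "\<not> q dvd n" if "n \<in> D P" for n
  proof
    assume "q dvd n"
    moreover have "n \<noteq> 0"
      using that unfolding D_def by (metis mem_Collect_eq not_squarefree_0)
    ultimately have "q \<in> prime_factors n"
      using q by (auto simp: in_prime_factors_iff)
    with that insert.hyps show False
      by (auto simp: D_def)
  qed
  have D_insert: "D (insert q P) = D P \<union> (*) q ` D P"
  proof (intro equalityI subsetI)
    fix n assume n: "n \<in> D (insert q P)"
    then have n0: "n \<noteq> 0"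
      unfolding D_def by (metis mem_Collect_eq not_squarefree_0)
    show "n \<in> D P \<union> (*) q ` D P"
    proof (cases "q dvd n")
      case True
      then obtain m where m: "n = q * m" ..
      have "\<not> q dvd m"
        using n q by (auto simp: D_def m power2_eq_square dest!: squarefreeD[of _ q])
      moreover have "squarefree m"
        using n m squarefree_multD by (auto simp: D_def)
      moreover have "prime_factors m \<subseteq> prime_factors n"
        using n0 m by (intro dvd_prime_factors) auto
      ultimately have "m \<in> D P"
        using n q by (auto simp: D_def in_prime_factors_iff)
      then show ?thesis
        by (auto simp: m)
    next
      case False
      then have "q \<notin> prime_factors n"
        by (auto simp: in_prime_factors_iff)
      then show ?thesis
        using n by (auto simp: D_def)
    qed
  next
    fix n assume "n \<in> D P \<union> (*) q ` D P"
    then show "n \<in> D (insert q P)"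
    proof
      assume "n \<in> (*) q ` D P"
      then obtain m where m: "m \<in> D P" "n = q * m"
        by auto
      then have "coprime q m"
        using nq[of m] q by (simp add: prime_imp_coprime)
      moreover have "m \<noteq> 0"
        using m unfolding D_def by (metis mem_Collect_eq not_squarefree_0)
      ultimately show ?thesis
        using m q by (auto simp: D_def squarefree_mult_coprime squarefree_prime
            prime_factors_product prime_prime_factors)
    qed (auto simp: D_def)
  qed
  have IH: "finite (D P)" "(\<Prod>p\<in>P. 1 - of_nat p powr -s) = (\<Sum>n\<in>D P. f n)"
    using insert by (auto simp: D_def f_def)
  have "(\<Sum>n\<in>D (insert q P). f n) = (\<Sum>n\<in>D P. f n) + (\<Sum>n\<in>(*) q ` D P. f n)"
    unfolding D_insert using IH
  proof (intro sum.union_disjoint)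
    show "D P \<inter> (*) q ` D P = {}"
      using nq by (metis disjoint_iff dvd_triv_left imageE)
  qed auto
  also have "(\<Sum>n\<in>(*) q ` D P. f n) = (\<Sum>n\<in>D P. f (q * n))"
    using q by (subst sum.reindex) (auto simp: inj_on_def)
  also have "\<dots> = (\<Sum>n\<in>D P. - (of_nat q powr -s) * f n)"
    using nq q by (intro sum.cong) (auto simp: f_def moebius_mu_prime_mult nat_powr_mult
        simp del: of_nat_mult)
  also have "\<dots> = - (of_nat q powr -s) * (\<Sum>n\<in>D P. f n)"
    by (simp add: sum_distrib_left)
  finally have "(\<Prod>p\<in>insert q P. 1 - of_nat p powr -s) = (\<Sum>n\<in>D (insert q P). f n)"
    using insert.hyps IH by (simp add: algebra_simps)
  moreover have "finite (D (insert q P))"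
    using IH by (simp add: D_insert)
  ultimately show ?case
    by (simp add: D_def f_def)
qed

text \<open>Apart from \<open>1\<close>, every positive integer surviving the sieve by the primes up to \<open>N\<close> exceeds \<open>N\<close>,
  so Tannery's theorem applies. Working with the factors \<open>1 - p\<^sup>-\<^sup>s\<close> instead of their inverses
  keeps all the sums free of multiplicities.\<close>

lemma euler_product_tendsto:
  assumes "Re s > 1"
  shows "(\<lambda>N. (\<Prod>p | prime p \<and> p \<le> N. 1 - of_nat p powr -s) * (\<Sum>n. of_nat n powr -s :: complex))
         \<longlonglongrightarrow> 1"
proof -
  define a where "a = (\<lambda>n N. of_bool (\<forall>p. prime p \<and> p \<le> N \<longrightarrow> \<not> p dvd n) * of_nat n powr -s :: complex)"
  have "(\<lambda>N. \<Sum>n. a n N) \<longlonglongrightarrow> (\<Sum>n. of_bool (n = 1) * of_nat n powr -s)"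
  proof (rule tannerys_theorem[THEN conjunct2, THEN conjunct2])
    show "((\<lambda>N. a n N) \<longlongrightarrow> of_bool (n = 1) * of_nat n powr -s) sequentially" for n
    proof (rule tendsto_eventually, rule eventually_sequentiallyI)
      fix N assume N: "n + 2 \<le> N"
      have "\<exists>p. prime p \<and> p \<le> N \<and> p dvd n" if "n \<noteq> 1"
      proof (cases "n = 0")
        case True
        then show ?thesis
          using N by (intro exI[of _ 2]) auto
      next
        case False
        then show ?thesis
          using prime_factor_nat[OF that] N by (meson add_leD1 dvd_imp_le le_trans neq0_conv)
      qed
      then show "a n N = of_bool (n = 1) * of_nat n powr -s"
        by (auto simp: a_def)
    qed
    show "\<forall>\<^sub>F (n, N) in at_top \<times>\<^sub>F sequentially. norm (a n N) \<le> norm (of_nat n powr -s :: complex)"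
      by (intro always_eventually) (auto simp: a_def)
    show "summable (\<lambda>n. norm (of_nat n powr -s :: complex))"
      by (rule summable_norm_nat_powr[OF assms])
  qed auto
  moreover have "(\<Sum>n. of_bool (n = 1) * of_nat n powr -s :: complex) = 1"
    by (subst suminf_finite[of "{1}"]) auto
  moreover have "(\<Prod>p | prime p \<and> p \<le> N. 1 - of_nat p powr -s) * (\<Sum>n. of_nat n powr -s :: complex)
      = (\<Sum>n. a n N)" for N
    by (subst euler_product_sieve[OF _ _ assms]) (auto simp: a_def intro: finite_subset[of _ "{..N}"])
  ultimately show ?thesis
    by simp
qed

definition moebius_away :: "nat set \<Rightarrow> nat \<Rightarrow> int" where
  "moebius_away B n = (if \<exists>p\<in>B. p dvd n then 0 else moebius_mu n)"

lemma norm_moebius_away_le_1: "norm (of_int (moebius_away B n) :: 'a :: real_normed_algebra_1) \<le> 1"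
  using moebius_mu_cases[of n] by (auto simp: moebius_away_def)

text \<open>Both factors are compared with the finite product of \<open>1 - p\<^sup>-\<^sup>s\<close> over the primes up to \<open>N\<close>
  outside \<open>B\<close>: it is a finite part of the series on the left, and times the second factor it is
  the full product over the primes up to \<open>N\<close>, which tends to \<open>1 / \<zeta>(s)\<close>.\<close>

lemma dirichlet_series_moebius_away:
  assumes "finite B" "\<And>p. p \<in> B \<Longrightarrow> prime p" "Re s > 1"
  shows "(\<Sum>n. of_int (moebius_away B n) * of_nat n powr -s) *
         ((\<Sum>n. of_nat n powr -s) * (\<Prod>p\<in>B. 1 - of_nat p powr -s)) = (1 :: complex)"
proof -
  define P where "P = (\<lambda>N. {p. prime p \<and> p \<le> N} - B)"
  define D where "D = (\<lambda>N. {n :: nat. squarefree n \<and> prime_factors n \<subseteq> P N})"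
  define e where "e = (\<lambda>p. 1 - of_nat p powr -s :: complex)"
  define Z where "Z = (\<Sum>n. of_nat n powr -s :: complex)"
  define a where "a = (\<lambda>n N. of_bool (n \<in> D N) * (of_int (moebius_mu n) * of_nat n powr -s) :: complex)"
  have finP: "finite (P N)" for N
    unfolding P_def by (rule finite_subset[of _ "{..N}"]) auto
  have prod_eq: "(\<Prod>p\<in>P N. e p) = (\<Sum>n. a n N)" for N
  proof -
    have *: "finite (D N)"
      "(\<Prod>p\<in>P N. e p) = (\<Sum>n\<in>D N. of_int (moebius_mu n) * of_nat n powr -s)"
      using euler_product_moebius_finite[OF finP[of N], of s] by (auto simp: P_def D_def e_def)
    show ?thesis
      unfolding *(2) by (subst suminf_finite[OF *(1)]) (auto simp: a_def)
  qed
  have "(\<lambda>N. \<Sum>n. a n N) \<longlonglongrightarrow> (\<Sum>n. of_int (moebius_away B n) * of_nat n powr -s)"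
  proof (rule tannerys_theorem[THEN conjunct2, THEN conjunct2])
    show "((\<lambda>N. a n N) \<longlongrightarrow> of_int (moebius_away B n) * of_nat n powr -s) sequentially" for n
    proof (rule tendsto_eventually, rule eventually_sequentiallyI)
      fix N assume N: "n \<le> N"
      show "a n N = of_int (moebius_away B n) * of_nat n powr -s"
      proof (cases "n = 0 \<or> \<not> squarefree n")
        case True
        then show ?thesis
          by (auto simp: a_def moebius_away_def moebius_mu_eq_0_iff)
      next
        case False
        have "p \<le> N" if "p dvd n" for p
          using dvd_imp_le[OF that] False N by simp
        then have "prime_factors n \<subseteq> P N \<longleftrightarrow> \<not> (\<exists>p\<in>B. p dvd n)"
          using False assms(2) by (auto simp: P_def prime_factors_dvd)
        then show ?thesis
          using False by (auto simp: a_def D_def moebius_away_def)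
      qed
    qed
    show "\<forall>\<^sub>F (n, N) in at_top \<times>\<^sub>F sequentially. norm (a n N) \<le> norm (of_nat n powr -s :: complex)"
    proof (intro always_eventually, safe)
      fix n N
      show "norm (a n N) \<le> norm (of_nat n powr -s :: complex)"
        using moebius_mu_cases[of n] by (auto simp: a_def norm_mult)
    qed
    show "summable (\<lambda>n. norm (of_nat n powr -s :: complex))"
      by (rule summable_norm_nat_powr[OF assms(3)])
  qed auto
  then have "(\<lambda>N. (\<Prod>p\<in>P N. e p) * (Z * (\<Prod>p\<in>B. e p))) \<longlonglongrightarrow>
      (\<Sum>n. of_int (moebius_away B n) * of_nat n powr -s) * (Z * (\<Prod>p\<in>B. e p))"
    unfolding prod_eq by (intro tendsto_intros)
  moreover have "(\<lambda>N. (\<Prod>p\<in>P N. e p) * (Z * (\<Prod>p\<in>B. e p))) \<longlonglongrightarrow> 1"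
  proof (rule Lim_transform_eventually)
    show "(\<lambda>N. (\<Prod>p | prime p \<and> p \<le> N. e p) * Z) \<longlonglongrightarrow> 1"
      using euler_product_tendsto[OF assms(3)] by (simp add: e_def Z_def)
    show "\<forall>\<^sub>F N in sequentially. (\<Prod>p | prime p \<and> p \<le> N. e p) * Z =
        (\<Prod>p\<in>P N. e p) * (Z * (\<Prod>p\<in>B. e p))"
    proof (rule eventually_sequentiallyI)
      fix N assume N: "Max (insert 0 B) \<le> N"
      have "B \<subseteq> {p. prime p \<and> p \<le> N}"
        using assms(1,2) N by auto
      moreover have "finite {p. prime p \<and> p \<le> N}"
        by (rule finite_subset[of _ "{..N}"]) auto
      ultimately have "(\<Prod>p | prime p \<and> p \<le> N. e p) = (\<Prod>p\<in>P N. e p) * (\<Prod>p\<in>B. e p)"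
        unfolding P_def by (rule prod.subset_diff)
      then show "(\<Prod>p | prime p \<and> p \<le> N. e p) * Z = (\<Prod>p\<in>P N. e p) * (Z * (\<Prod>p\<in>B. e p))"
        by simp
    qed
  qed
  ultimately show ?thesis
    using LIMSEQ_unique by (auto simp: e_def Z_def)
qed

section \<open>Zeta on the line of real part one\<close>

text \<open>These series define \<open>z \<zeta>(1 + z)\<close>, in a form that converges for \<open>Re z > -1\<close>: the terms
  are Taylor remainders of second order of the function \<open>x\<^sup>-\<^sup>z\<close> on the intervals from \<open>n + 1\<close> to
  \<open>n + 2\<close>.\<close>

definition zeta_reg_term :: "nat \<Rightarrow> complex \<Rightarrow> complex" where
  "zeta_reg_term n z = z * of_nat (Suc n) powr -(1 + z) - of_nat (Suc n) powr -z
     + of_nat (Suc (Suc n)) powr -z"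

definition zeta_reg :: "complex \<Rightarrow> complex" where
  "zeta_reg z = 1 + (\<Sum>n. zeta_reg_term n z)"

lemma norm_zeta_reg_term_le:
  assumes "Re z > -1"
  shows "norm (zeta_reg_term n z) \<le> norm z * norm (z + 1) * real (Suc n) powr (-Re z - 2)"
proof -
  define S where "S = closed_segment (of_nat (Suc n)) (of_nat (Suc (Suc n)) :: complex)"
  define f where "f = (\<lambda>(i :: nat) w. if i = 0 then w powr -z else if i = 1 then -z * w powr (-z - 1)
    else z * (z + 1) * w powr (-z - 2) :: complex)"
  have S_eq: "S = of_real ` {real (Suc n)..real (Suc (Suc n))}"
    using closed_segment_of_real[of "real (Suc n)" "real (Suc (Suc n))"]
    by (simp add: S_def closed_segment_eq_real_ivl del: of_nat_Suc)
  have "norm (f 0 (of_nat (Suc (Suc n))) - (\<Sum>i\<le>1. f i (of_nat (Suc n)) *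
      (of_nat (Suc (Suc n)) - of_nat (Suc n)) ^ i / fact i))
     \<le> (norm z * norm (z + 1) * real (Suc n) powr (-Re z - 2)) *
        norm (of_nat (Suc (Suc n)) - of_nat (Suc n) :: complex) ^ Suc 1 / fact 1"
  proof (rule complex_Taylor)
    show "convex S"
      by (simp add: S_def)
    show "of_nat (Suc n) \<in> S" "of_nat (Suc (Suc n)) \<in> S"
      by (simp_all add: S_def)
    show "(f i has_field_derivative f (Suc i) w) (at w within S)" if w_in: "w \<in> S" and i_le: "i \<le> 1" for i w
    proof -
      have w: "w \<notin> \<real>\<^sub>\<le>\<^sub>0"
        using w_in by (auto simp: S_eq)
      consider "i = 0" | "i = 1"
        using i_le by linarith
      then show ?thesis
      proof cases
        case 1
        show ?thesis
          using w unfolding 1 f_def by (auto intro!: derivative_eq_intros)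
      next
        case 2
        show ?thesis
          using w unfolding 2 f_def by (auto intro!: derivative_eq_intros simp: algebra_simps)
      qed
    qed
    show "norm (f (Suc 1) w) \<le> norm z * norm (z + 1) * real (Suc n) powr (-Re z - 2)"
      if w_in: "w \<in> S" for w
    proof -
      obtain t where t: "w = of_real t" "real (Suc n) \<le> t"
        using w_in by (auto simp: S_eq)
      have "norm (w powr (-z - 2)) = t powr (-Re z - 2)"
        using t by (simp add: norm_powr_real_powr)
      also have "\<dots> \<le> real (Suc n) powr (-Re z - 2)"
        using t assms by (intro powr_mono2') auto
      finally show ?thesis
        by (auto simp: f_def norm_mult intro!: mult_left_mono)
    qed
  qed
  moreover have "f 0 (of_nat (Suc (Suc n))) - (\<Sum>i\<le>1. f i (of_nat (Suc n)) *
      (of_nat (Suc (Suc n)) - of_nat (Suc n)) ^ i / fact i) = zeta_reg_term n z"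
  proof -
    have "-(1 + z) = -z - 1"
      by simp
    then show ?thesis
      by (simp only: f_def zeta_reg_term_def) simp
  qed
  ultimately show ?thesis
    by simp
qed

lemma zeta_reg_differentiable:
  assumes "Re z > -1/2"
  shows "summable (\<lambda>n. zeta_reg_term n z)" "zeta_reg field_differentiable at z"
proof -
  define S where "S = {z :: complex. Re z > -1/2}"
  have "open S"
    unfolding S_def by (rule open_halfspace_Re_gt)
  have diff: "zeta_reg_term n field_differentiable at x" for n x
  proof -
    have powr: "(\<lambda>z. of_nat (Suc m) powr g z) field_differentiable at x"
      if "g field_differentiable at x" for m and g :: "complex \<Rightarrow> complex"
    proof -
      have "(\<lambda>z. exp (g z * Ln (of_nat (Suc m)))) field_differentiable at x"
        using field_differentiable_compose[OF
            field_differentiable_mult[OF that field_differentiable_const]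
            field_differentiable_within_exp, unfolded o_def] .
      then show ?thesis
        by (simp add: powr_def del: of_nat_Suc)
    qed
    show ?thesis
      unfolding zeta_reg_term_def [abs_def] by (intro derivative_intros powr)
  qed
  have bound: "\<exists>d h. 0 < d \<and> summable h \<and> range h \<subseteq> \<real>\<^sub>\<ge>\<^sub>0 \<and>
       (\<forall>\<^sub>F n in sequentially. \<forall>y\<in>ball x d \<inter> S. cmod (zeta_reg_term n y) \<le> cmod (h n))"
    if "x \<in> S" for x
  proof -
    define h where "h = (\<lambda>n. (norm x + 1) * (norm x + 2) * real (Suc n) powr (-3/2))"
    have "summable (\<lambda>n. real n powr (-3/2))"
      by (simp add: summable_real_powr_iff)
    then have "summable (\<lambda>n. real (Suc n) powr (-3/2))"
      by (subst summable_Suc_iff)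
    then have "summable h"
      unfolding h_def by (rule summable_mult)
    have "norm (zeta_reg_term n y) \<le> h n" if y: "y \<in> ball x 1 \<inter> S" for n y
    proof -
      have "norm y \<le> norm x + 1"
        using y norm_triangle_ineq2[of y x] by (simp add: dist_norm norm_minus_commute)
      moreover have "norm (y + 1) \<le> norm y + 1"
        using norm_triangle_ineq[of y 1] by simp
      moreover have "real (Suc n) powr (-Re y - 2) \<le> real (Suc n) powr (-3/2)"
      proof (rule powr_mono)
        have "Re y > -1/2"
          using y by (simp add: S_def)
        then show "-Re y - 2 \<le> -3/2"
          by argo
      qed auto
      ultimately have "norm y * norm (y + 1) * real (Suc n) powr (-Re y - 2) \<le> h n"
        unfolding h_def by (intro mult_mono) auto
      moreover have "Re y > -1"
        using y by (auto simp: S_def)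
      ultimately show ?thesis
        using norm_zeta_reg_term_le[of y n] by linarith
    qed
    then have "\<forall>\<^sub>F n in sequentially. \<forall>y\<in>ball x 1 \<inter> S. cmod (zeta_reg_term n y) \<le> cmod (complex_of_real (h n))"
      by (intro always_eventually) (simp add: h_def del: of_real_mult of_real_add)
    moreover have "summable (\<lambda>n. complex_of_real (h n))"
      using \<open>summable h\<close> by (rule summable_of_real)
    moreover have "range (\<lambda>n. complex_of_real (h n)) \<subseteq> \<real>\<^sub>\<ge>\<^sub>0"
      by (auto simp: h_def)
    ultimately show ?thesis
      by (intro exI[of _ 1] exI[of _ "\<lambda>n. complex_of_real (h n)"]) auto
  qed
  obtain g where g: "\<forall>x\<in>S. (\<lambda>n. zeta_reg_term n x) sums g x \<and> g field_differentiable at x"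
    using series_differentiable_comparison_complex[OF \<open>open S\<close> diff bound] by blast
  have z: "z \<in> S"
    using assms by (simp add: S_def)
  show "summable (\<lambda>n. zeta_reg_term n z)"
    using g z sums_summable by blast
  have "(\<lambda>x. 1 + g x) field_differentiable at z"
    using g z by (intro derivative_intros) auto
  moreover have "1 + g x = zeta_reg x" if "x \<in> S" for x
    using g that unfolding zeta_reg_def by (metis sums_unique)
  ultimately show "zeta_reg field_differentiable at z"
    unfolding field_differentiable_def
    using has_field_derivative_transform_within_open[OF _ \<open>open S\<close> z] by blast
qed

lemma zeta_reg_0: "zeta_reg 0 = 1"
proof -
  have "zeta_reg_term n 0 = 0" for n
    by (simp add: zeta_reg_term_def del: of_nat_Suc)
  then show ?thesis
    by (simp add: zeta_reg_def)
qed

lemma zeta_reg_eq_zeta: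
  assumes "Re z > 0"
  shows "zeta_reg z = z * (\<Sum>n. of_nat n powr (-(1 + z)))"
proof -
  have "summable (\<lambda>n. of_nat n powr (-(1 + z)) :: complex)"
    using summable_norm_nat_powr[of "1 + z"] assms by (auto dest: summable_norm_cancel)
  then have "(\<lambda>n. of_nat n powr (-(1 + z)) :: complex) sums (\<Sum>n. of_nat n powr (-(1 + z)))"
    by (rule summable_sums)
  then have "(\<lambda>n. of_nat (Suc n) powr (-(1 + z)) :: complex) sums (\<Sum>n. of_nat n powr (-(1 + z)))"
    by (subst sums_Suc_iff) simp
  then have "(\<lambda>n. z * of_nat (Suc n) powr (-(1 + z)) :: complex) sums
      (z * (\<Sum>n. of_nat n powr (-(1 + z))))"
    by (rule sums_mult)
  moreover have "(\<lambda>n. of_nat (Suc (Suc n)) powr -z - of_nat (Suc n) powr -z :: complex) sums (0 - 1)"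
  proof -
    have "(\<lambda>n. of_nat (Suc n) powr -z :: complex) \<longlonglongrightarrow> 0"
    proof (rule tendsto_norm_zero_cancel)
      have "(\<lambda>n. real (Suc n) powr - Re z) \<longlonglongrightarrow> 0"
        using assms by real_asymp
      then show "(\<lambda>n. norm (of_nat (Suc n) powr -z :: complex)) \<longlonglongrightarrow> 0"
        by (simp add: norm_nat_powr del: of_nat_Suc)
    qed
    from telescope_sums[OF this] show ?thesis
      by simp
  qed
  ultimately have "(\<lambda>n. zeta_reg_term n z) sums (z * (\<Sum>n. of_nat n powr (-(1 + z))) + (0 - 1))"
  proof (rule sums_add[THEN back_subst[of "\<lambda>f. f sums _"]])
    show "(\<lambda>n. z * of_nat (Suc n) powr (-(1 + z)) +
        (of_nat (Suc (Suc n)) powr -z - of_nat (Suc n) powr -z)) = (\<lambda>n. zeta_reg_term n z)"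
      by (simp add: zeta_reg_term_def fun_eq_iff)
  qed
  then show ?thesis
    by (simp add: zeta_reg_def sums_iff)
qed

text \<open>One Euler factor of the classical inequality behind non-vanishing: taking logarithms,
  the \<open>n\<close>-th power series coefficient is \<open>-r\<^sup>n (3 + 4 cos n\<theta> + cos 2n\<theta>) / n\<close>, and
  \<open>3 + 4 cos n\<theta> + cos 2n\<theta> = 2 (1 + cos n\<theta>)\<^sup>2\<close>.\<close>

lemma mertens_3_4_1_factor:
  fixes r :: real and u :: complex
  assumes r: "0 < r" "r < 1" and u: "norm u = 1"
  shows "norm (1 - of_real r :: complex) ^ 3 * norm (1 - of_real r * u) ^ 4 *
         norm (1 - of_real r * u\<^sup>2) \<le> 1"
proof -
  define l where "l = (\<lambda>w. Re (ln (1 - w :: complex)))"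
  have l_sums: "(\<lambda>n. - Re (w ^ n) / real n) sums l w" if "norm w < 1" for w
    using sums_Re[OF Ln_series'[of "-w"]] that by (simp add: l_def)
  have norm_eq: "norm (1 - w) = exp (l w)" if "norm w < 1" for w
  proof -
    have "1 - w \<noteq> 0"
      using that by auto
    then have "norm (1 - w) = norm (exp (ln (1 - w)))"
      by simp
    then show ?thesis
      by (simp only: norm_exp_eq_Re l_def)
  qed
  have small: "norm (of_real r :: complex) < 1" "norm (of_real r * u) < 1" "norm (of_real r * u\<^sup>2) < 1"
    using r u by (simp_all add: norm_mult norm_power)
  have "(\<lambda>n. 3 * (- Re (of_real r ^ n) / real n) + 4 * (- Re ((of_real r * u) ^ n) / real n)
        + - Re ((of_real r * u\<^sup>2) ^ n) / real n)
        sums (3 * l (of_real r) + 4 * l (of_real r * u) + l (of_real r * u\<^sup>2))"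
    by (intro sums_add sums_mult l_sums small)
  moreover have "3 * (- Re (of_real r ^ n) / real n) + 4 * (- Re ((of_real r * u) ^ n) / real n)
        + - Re ((of_real r * u\<^sup>2) ^ n) / real n \<le> 0" for n
  proof -
    define c where "c = Re (u ^ n)"
    have "norm (u ^ n) = 1"
      using u by (simp add: norm_power)
    then have "(Re (u ^ n))\<^sup>2 + (Im (u ^ n))\<^sup>2 = 1"
      by (metis cmod_power2 one_power2)
    then have c2: "Re ((u ^ n)\<^sup>2) = 2 * c\<^sup>2 - 1"
      by (simp add: c_def power2_eq_square)
    have "Re (of_real r ^ n) = r ^ n"
      by (metis Re_complex_of_real of_real_power)
    moreover have "Re ((of_real r * u) ^ n) = r ^ n * c"
      by (simp add: power_mult_distrib c_def flip: of_real_power)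
    moreover have "Re ((of_real r * u\<^sup>2) ^ n) = r ^ n * (2 * c\<^sup>2 - 1)"
    proof -
      have "(of_real r * u\<^sup>2) ^ n = of_real (r ^ n) * (u ^ n)\<^sup>2"
        by (simp add: power_mult_distrib mult.commute flip: power_mult)
      then show ?thesis
        using c2 by (simp del: of_real_power)
    qed
    ultimately have "3 * (- Re (of_real r ^ n) / real n) + 4 * (- Re ((of_real r * u) ^ n) / real n)
        + - Re ((of_real r * u\<^sup>2) ^ n) / real n = - (2 * r ^ n * (1 + c)\<^sup>2 / real n)"
      by (simp only:) (simp add: algebra_simps power2_eq_square add_divide_distrib diff_divide_distrib)
    also have "\<dots> \<le> 0"
      using r by simp
    finally show ?thesis .
  qed
  ultimately have "3 * l (of_real r) + 4 * l (of_real r * u) + l (of_real r * u\<^sup>2) \<le> 0"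
    by (rule sums_le[OF _ _ sums_zero, rotated])
  then have "exp (3 * l (of_real r) + 4 * l (of_real r * u) + l (of_real r * u\<^sup>2)) \<le> 1"
    by simp
  also have "exp (3 * l (of_real r) + 4 * l (of_real r * u) + l (of_real r * u\<^sup>2)) =
      exp (l (of_real r)) ^ 3 * exp (l (of_real r * u)) ^ 4 * exp (l (of_real r * u\<^sup>2))"
    by (simp add: exp_add flip: exp_of_nat_mult)
  finally show ?thesis
    by (simp only: norm_eq small)
qed

text \<open>The inequality for \<open>\<zeta>\<close> is the limit of the product of the inequalities for its factors,
  which are inverted because the products of \<open>1 - p\<^sup>-\<^sup>s\<close> approach \<open>1 / \<zeta>(s)\<close>.\<close>

lemma mertens_3_4_1:
  fixes x t :: real
  assumes "x > 0"
  defines "\<zeta> \<equiv> \<lambda>y. norm (\<Sum>n. of_nat n powr (-Complex (1 + x) y) :: complex)"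
  shows "1 \<le> \<zeta> 0 ^ 3 * \<zeta> t ^ 4 * \<zeta> (2 * t)"
proof -
  define E where "E = (\<lambda>N y. \<Prod>p | prime p \<and> p \<le> N. 1 - of_nat p powr -Complex (1 + x) y :: complex)"
  have lim: "(\<lambda>N. norm (E N y) * \<zeta> y) \<longlonglongrightarrow> 1" for y
    using tendsto_norm[OF euler_product_tendsto[of "Complex (1 + x) y"]] assms(1)
    by (simp add: E_def \<zeta>_def norm_mult)
  have le: "norm (E N 0) ^ 3 * norm (E N t) ^ 4 * norm (E N (2 * t)) \<le> 1" for N
  proof -
    have "norm (E N 0) ^ 3 * norm (E N t) ^ 4 * norm (E N (2 * t)) =
      (\<Prod>p | prime p \<and> p \<le> N. norm (1 - of_nat p powr -Complex (1 + x) 0 :: complex) ^ 3 *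
        norm (1 - of_nat p powr -Complex (1 + x) t :: complex) ^ 4 *
        norm (1 - of_nat p powr -Complex (1 + x) (2 * t) :: complex))"
      unfolding E_def prod_norm [symmetric] prod_power_distrib prod.distrib [symmetric] ..
    also have "\<dots> \<le> 1"
    proof (rule prod_le_1, safe)
      fix p :: nat assume p: "prime p"
      define r where "r = real p powr -(1 + x)"
      define u where "u = (of_nat p powr -(\<i> * of_real t) :: complex)"
      have p1: "1 < real p"
        using prime_gt_1_nat[OF p] by simp
      have "of_nat p powr -Complex (1 + x) (real k * t) = of_real r * u ^ k" for k
      proof -
        have "-Complex (1 + x) (real k * t) = of_real (-(1 + x)) + of_nat k * (-(\<i> * of_real t))"
          by (simp add: complex_eq_iff)
        then have "of_nat p powr -Complex (1 + x) (real k * t) =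
            of_nat p powr of_real (-(1 + x)) * u ^ k"
          by (simp only: powr_add u_def) (simp add: powr_def flip: exp_of_nat_mult, simp add: mult_ac)
        also have "(of_nat p powr of_real (-(1 + x)) :: complex) = of_real r"
          unfolding r_def by (subst powr_of_real[symmetric]) auto
        finally show ?thesis .
      qed
      from this[of 0] this[of 1] this[of 2] have eqs:
        "of_nat p powr -Complex (1 + x) 0 = of_real r"
        "of_nat p powr -Complex (1 + x) t = of_real r * u"
        "of_nat p powr -Complex (1 + x) (2 * t) = of_real r * u\<^sup>2"
        by simp_all
      have "r > 0"
        using p1 by (simp add: r_def)
      moreover have "r < 1"
        unfolding r_def using p1 assms(1) by (subst powr_less_one) auto
      moreover have "norm u = 1"
        using p1 by (simp add: u_def norm_nat_powr)
      ultimately show "norm (1 - of_nat p powr -Complex (1 + x) 0 :: complex) ^ 3 *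
        norm (1 - of_nat p powr -Complex (1 + x) t :: complex) ^ 4 *
        norm (1 - of_nat p powr -Complex (1 + x) (2 * t) :: complex) \<le> 1"
        unfolding eqs by (rule mertens_3_4_1_factor)
    qed auto
    finally show ?thesis .
  qed
  have "(\<lambda>N. (norm (E N 0) * \<zeta> 0) ^ 3 * (norm (E N t) * \<zeta> t) ^ 4 * (norm (E N (2 * t)) * \<zeta> (2 * t)))
     \<longlonglongrightarrow> 1 ^ 3 * 1 ^ 4 * 1"
    by (intro tendsto_intros lim)
  moreover have "(norm (E N 0) * \<zeta> 0) ^ 3 * (norm (E N t) * \<zeta> t) ^ 4 * (norm (E N (2 * t)) * \<zeta> (2 * t))
     \<le> \<zeta> 0 ^ 3 * \<zeta> t ^ 4 * \<zeta> (2 * t)" for N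
  proof -
    have "(norm (E N 0) * \<zeta> 0) ^ 3 * (norm (E N t) * \<zeta> t) ^ 4 * (norm (E N (2 * t)) * \<zeta> (2 * t))
       = (norm (E N 0) ^ 3 * norm (E N t) ^ 4 * norm (E N (2 * t))) * (\<zeta> 0 ^ 3 * \<zeta> t ^ 4 * \<zeta> (2 * t))"
      by (simp add: power_mult_distrib mult_ac)
    also have "\<dots> \<le> 1 * (\<zeta> 0 ^ 3 * \<zeta> t ^ 4 * \<zeta> (2 * t))"
      by (intro mult_right_mono le) (auto simp: \<zeta>_def)
    finally show ?thesis by simp
  qed
  ultimately show ?thesis
    by (intro LIMSEQ_le_const2[of _ 1]) auto
qed

text \<open>At a zero \<open>1 + it\<close> of \<open>\<zeta>\<close> with \<open>t \<noteq> 0\<close>, the product in \<open>mertens_3_4_1\<close> would be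
  \<open>O(x)\<close> as \<open>x\<close> tends to \<open>0\<close>: the fourth power of the zero outweighs the third power of the
  pole at \<open>1\<close>.\<close>

lemma zeta_reg_nonzero:
  assumes "Re z \<ge> 0"
  shows "zeta_reg z \<noteq> 0"
proof (cases "Re z > 0")
  case True
  then have "(\<Sum>n. of_nat n powr -(1 + z)) \<noteq> (0 :: complex)"
    using dirichlet_series_moebius_away[of "{}" "1 + z"] by auto
  moreover have "z \<noteq> 0"
    using True by auto
  ultimately show ?thesis
    using True by (simp add: zeta_reg_eq_zeta)
next
  case False
  define t where "t = Im z"
  have z: "z = Complex 0 t"
    using False assms by (simp add: complex_eq_iff t_def)
  show ?thesis
  proof (cases "t = 0")
    case True
    then have "z = 0"
      using z by (simp add: complex_eq_iff)
    then show ?thesis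
      by (simp add: zeta_reg_0)
  next
    case False
    show ?thesis
    proof
      assume zero: "zeta_reg z = 0"
      define Z where "Z = (\<lambda>y x. zeta_reg (Complex x y))"
      define D where "D = deriv zeta_reg z"
      have Complex_lim: "((\<lambda>x. Complex x y) \<longlongrightarrow> Complex 0 y) (at_right 0)" for y
        by (intro tendsto_intros)
      have Z_lim: "((\<lambda>x. Z y x) \<longlongrightarrow> Z y 0) (at_right 0)" for y
      proof -
        have "isCont zeta_reg (Complex 0 y)"
          by (intro field_differentiable_imp_continuous_at zeta_reg_differentiable) simp
        then show ?thesis
          unfolding Z_def by (rule isCont_tendsto_compose[OF _ Complex_lim])
      qed
      have "(zeta_reg has_field_derivative D) (at z)"
        unfolding D_def using assms
        by (intro field_differentiable_derivI zeta_reg_differentiable) simp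
      then have "(\<lambda>w. (zeta_reg w - zeta_reg z) / (w - z)) \<midarrow>z\<rightarrow> D"
        by (simp add: has_field_derivative_iff)
      moreover have "filterlim (\<lambda>x. Complex x t) (at z) (at_right 0)"
        unfolding filterlim_at using Complex_lim[of t]
        by (auto simp: z complex_eq_iff eventually_at_filter)
      ultimately have "((\<lambda>x. (zeta_reg (Complex x t) - zeta_reg z) / (Complex x t - z)) \<longlongrightarrow> D) (at_right 0)"
        by (rule filterlim_compose)
      moreover have "Complex x t - z = of_real x" for x
        by (simp add: z complex_eq_iff)
      ultimately have Z_div: "((\<lambda>x. Z t x / of_real x) \<longlongrightarrow> D) (at_right 0)"
        using zero by (simp add: Z_def)
      have "((\<lambda>x. x * (norm (Z 0 x) ^ 3 * (norm (Z t x / of_real x) / norm (Complex x t)) ^ 4 *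
              (norm (Z (2 * t) x) / norm (Complex x (2 * t))))) \<longlongrightarrow>
            0 * (norm (Z 0 0) ^ 3 * (norm D / norm (Complex 0 t)) ^ 4 *
              (norm (Z (2 * t) 0) / norm (Complex 0 (2 * t))))) (at_right 0)"
        using False
        by (intro tendsto_intros Z_div Z_lim Complex_lim) (auto simp: complex_eq_iff)
      moreover have "\<forall>\<^sub>F x in at_right 0. 1 \<le> x * (norm (Z 0 x) ^ 3 *
            (norm (Z t x / of_real x) / norm (Complex x t)) ^ 4 *
              (norm (Z (2 * t) x) / norm (Complex x (2 * t))))"
        unfolding eventually_at_right_field
      proof (intro exI[of _ 1] conjI allI impI)
        fix x :: real assume x: "0 < x" "x < 1"
        have "norm (\<Sum>n. of_nat n powr (-Complex (1 + x) y) :: complex) = norm (Z y x) / norm (Complex x y)"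
          for y
        proof -
          have "Complex (1 + x) y = 1 + Complex x y"
            by (simp add: complex_eq_iff)
          moreover have "Complex x y \<noteq> 0"
            using x by (simp add: complex_eq_iff)
          ultimately show ?thesis
            using x by (simp add: Z_def zeta_reg_eq_zeta norm_mult)
        qed
        then have "1 \<le> (norm (Z 0 x) / norm (Complex x 0)) ^ 3 * (norm (Z t x) / norm (Complex x t)) ^ 4
            * (norm (Z (2 * t) x) / norm (Complex x (2 * t)))"
          using mertens_3_4_1[OF x(1), of t] by simp
        also have "norm (Complex x 0) = x"
          using x by (simp add: cmod_def)
        also have "(norm (Z 0 x) / x) ^ 3 * (norm (Z t x) / norm (Complex x t)) ^ 4
            * (norm (Z (2 * t) x) / norm (Complex x (2 * t))) =
            x * (norm (Z 0 x) ^ 3 *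
            (norm (Z t x / of_real x) / norm (Complex x t)) ^ 4 *
              (norm (Z (2 * t) x) / norm (Complex x (2 * t))))"
          using x by (simp add: norm_divide power_divide) (simp add: field_simps eval_nat_numeral)
        finally show "1 \<le> x * (norm (Z 0 x) ^ 3 *
            (norm (Z t x / of_real x) / norm (Complex x t)) ^ 4 *
              (norm (Z (2 * t) x) / norm (Complex x (2 * t))))" .
      qed auto
      ultimately have "1 \<le> 0 * (norm (Z 0 0) ^ 3 * (norm D / norm (Complex 0 t)) ^ 4 *
              (norm (Z (2 * t) 0) / norm (Complex 0 (2 * t))))"
        by (rule tendsto_lowerbound) simp
      then show False
        by simp
    qed
  qed
qed

section \<open>A Tauberian theorem of Newman type\<close>

text \<open>Shifting the integration variable by half a period of the oscillation changes the sign of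
  the integral, so twice the integral is bounded by the modulus of continuity of \<open>h\<close>. Vanishing
  at the end points makes the extension of \<open>h\<close> by zero continuous.\<close>

lemma riemann_lebesgue:
  fixes h :: "real \<Rightarrow> complex"
  assumes cont: "continuous_on {0..1} h" and ends: "h 0 = 0" "h 1 = 0"
  shows "((\<lambda>\<omega>. integral {0..1} (\<lambda>x. h x * cis (\<omega> * x))) \<longlongrightarrow> 0) at_top"
proof (rule tendstoI)
  fix e :: real assume "e > 0"
  define H where "H = (\<lambda>x. h (max 0 (min 1 x)))"
  have H_out: "H x = 0" if "x \<notin> {0..1}" for x
    using that ends by (auto simp: H_def min_def max_def)
  have contH: "continuous_on UNIV H"
    unfolding H_def
    by (rule continuous_on_compose2[OF cont]) (auto intro!: continuous_intros)
  have "uniformly_continuous_on {-1..3} H"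
    by (intro compact_uniformly_continuous continuous_on_subset[OF contH]) auto
  then obtain d where d: "d > 0"
    "\<And>x y. x \<in> {-1..3} \<Longrightarrow> y \<in> {-1..3} \<Longrightarrow> dist y x < d \<Longrightarrow> dist (H y) (H x) < e / 3"
    unfolding uniformly_continuous_on_def using \<open>e > 0\<close> by (metis divide_pos_pos zero_less_numeral)
  show "\<forall>\<^sub>F \<omega> in at_top. dist (integral {0..1} (\<lambda>x. h x * cis (\<omega> * x))) 0 < e"
    using eventually_gt_at_top[of "max pi (pi / d)"]
  proof eventually_elim
    case (elim \<omega>)
    define s where "s = pi / \<omega>"
    have \<omega>: "\<omega> > 0"
      using elim pi_gt_zero by linarith
    have s: "0 < s" "s < 1" "s < d" "\<omega> * s = pi"
      using elim \<omega> d(1) by (auto simp: s_def field_simps)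
    define f where "f = (\<lambda>x. H x * cis (\<omega> * x))"
    define I where "I = integral {0..1} f"
    have "f integrable_on {0..1}"
      unfolding f_def
      by (intro integrable_continuous_real continuous_intros continuous_on_subset[OF contH]) auto
    then have "(f has_integral I) {0..1}"
      unfolding I_def by (rule integrable_integral)
    then have I: "(f has_integral I) T" if "{0..1} \<subseteq> T" for T
      by (rule has_integral_on_superset) (use H_out that in \<open>auto simp: f_def\<close>)
    have "((f \<circ> (+) s) has_integral I) {-1..2}"
      unfolding has_integral_shift_Icc_real using s by (intro I) auto
    from has_integral_add[OF I this]
    have "((\<lambda>x. f x + f (s + x)) has_integral (I + I)) {-1..2}"
      by (simp add: o_def)
    moreover have "norm (f x + f (s + x)) \<le> e / 3" if "x \<in> {-1..2}" for x
    proof -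
      have "cis (\<omega> * (s + x)) = - cis (\<omega> * x)"
        using s by (simp add: distrib_left flip: cis_mult)
      then have "f x + f (s + x) = (H x - H (s + x)) * cis (\<omega> * x)"
        by (simp add: f_def algebra_simps)
      then have "norm (f x + f (s + x)) = dist (H x) (H (s + x))"
        by (simp add: norm_mult dist_norm)
      also have "\<dots> < e / 3"
        using s that by (intro d(2)) (auto simp: dist_real_def)
      finally show ?thesis
        by simp
    qed
    ultimately have "norm (I + I) \<le> e / 3 * measure lborel {-1..2::real}"
      using \<open>e > 0\<close> has_integral_bound_real[of "e / 3" "{}" "\<lambda>x. f x + f (s + x)" "I + I" "-1" 2] by simp
    then have "2 * norm I \<le> e"
      using norm_mult[of 2 I] by simp
    then have "norm I < e"
      using \<open>e > 0\<close> by linarith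
    moreover have "I = integral {0..1} (\<lambda>x. h x * cis (\<omega> * x))"
      unfolding I_def f_def by (intro integral_cong) (auto simp: H_def)
    ultimately show ?case
      by simp
  qed
qed

text \<open>The two sums of powers below are compared with telescoping sums; the mean value theorem
  supplies each step.\<close>

lemma powr_step:
  fixes a y :: real
  assumes "a > 0"
  obtains \<xi> where "a < \<xi>" "\<xi> < a + 1" "(a + 1) powr y - a powr y = y * \<xi> powr (y - 1)"
proof -
  have "\<exists>\<xi>>a. \<xi> < a + 1 \<and> (a + 1) powr y - a powr y = (a + 1 - a) * (y * \<xi> powr (y - 1))"
    using assms by (intro MVT2) (auto intro!: derivative_eq_intros)
  then show ?thesis
    using that by auto
qed

lemma sum_powr_le:
  fixes y :: real
  assumes "y > 0" "N \<ge> 1"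
  shows "(\<Sum>n=1..N. real n powr (y - 1)) \<le> real N powr y / y + real N powr (y - 1)"
proof (cases "y \<le> 1")
  case True
  have "(\<Sum>n=1..N. real n powr (y - 1)) \<le> real N powr y / y"
    using \<open>N \<ge> 1\<close>
  proof (induction N rule: dec_induct)
    case base
    then show ?case
      using True assms by simp
  next
    case (step n)
    obtain \<xi> where \<xi>: "real n < \<xi>" "\<xi> < real n + 1"
      "(real n + 1) powr y - real n powr y = y * \<xi> powr (y - 1)"
      using powr_step[of "real n" y] step.hyps by auto
    have "(real n + 1) powr (y - 1) \<le> \<xi> powr (y - 1)"
      using \<xi> True step.hyps by (intro powr_mono2') auto
    then have "y * (real n + 1) powr (y - 1) \<le> (real n + 1) powr y - real n powr y"
      using \<xi> assms by simp
    then have "(real n + 1) powr (y - 1) \<le> (real n + 1) powr y / y - real n powr y / y"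
      using assms by (simp add: field_simps)
    then show ?case
      using step by (simp add: add.commute)
  qed
  then show ?thesis
    by (simp add: add_increasing2)
next
  case False
  show ?thesis
    using \<open>N \<ge> 1\<close>
  proof (induction N rule: dec_induct)
    case base
    then show ?case
      using assms by simp
  next
    case (step n)
    obtain \<xi> where \<xi>: "real n < \<xi>" "\<xi> < real n + 1"
      "(real n + 1) powr y - real n powr y = y * \<xi> powr (y - 1)"
      using powr_step[of "real n" y] step.hyps by auto
    have "real n powr (y - 1) \<le> \<xi> powr (y - 1)"
      using \<xi> False step.hyps by (intro powr_mono2) auto
    then have "y * real n powr (y - 1) \<le> (real n + 1) powr y - real n powr y"
      using \<xi> assms by simp
    then have "real n powr (y - 1) \<le> (real n + 1) powr y / y - real n powr y / y"
      using assms by (simp add: field_simps)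
    then show ?case
      using step by (simp add: add.commute)
  qed
qed

lemma suminf_powr_tail_le:
  fixes x :: real
  assumes "x > 0" "N \<ge> 1"
  shows "summable (\<lambda>n. real (n + Suc N) powr -(1 + x))"
    and "(\<Sum>n. real (n + Suc N) powr -(1 + x)) \<le> real N powr -x / x"
proof -
  have "(\<lambda>n. real (n + N) powr -x) \<longlonglongrightarrow> 0"
    using assms by real_asymp
  from sums_divide[OF telescope_sums'[OF this], of x]
  have sums: "(\<lambda>n. (real (n + N) powr -x - real (Suc n + N) powr -x) / x) sums (real N powr -x / x)"
    by simp
  have le: "real (n + Suc N) powr -(1 + x) \<le> (real (n + N) powr -x - real (Suc n + N) powr -x) / x" for n
  proof -
    obtain \<xi> where \<xi>: "real (n + N) < \<xi>" "\<xi> < real (n + N) + 1"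
      "(real (n + N) + 1) powr -x - real (n + N) powr -x = -x * \<xi> powr (-x - 1)"
      using powr_step[of "real (n + N)" "-x"] assms by auto
    have eq: "-x - 1 = -(1 + x)"
      by simp
    have "(real (n + N) + 1) powr -(1 + x) \<le> \<xi> powr -(1 + x)"
      using \<xi> assms by (intro powr_mono2') auto
    then have "x * (real (n + N) + 1) powr -(1 + x) \<le> x * \<xi> powr -(1 + x)"
      using assms by simp
    also have "\<dots> = real (n + N) powr -x - (real (n + N) + 1) powr -x"
      using \<xi>(3) unfolding eq by simp
    finally show ?thesis
      using assms by (simp add: field_simps)
  qed
  show *: "summable (\<lambda>n. real (n + Suc N) powr -(1 + x))"
    by (rule summable_comparison_test'[OF sums_summable[OF sums], of 0]) (use le in auto)
  show "(\<Sum>n. real (n + Suc N) powr -(1 + x)) \<le> real N powr -x / x"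
    using suminf_le[OF le * sums_summable[OF sums]] sums_unique[OF sums] by simp
qed

text \<open>Cauchy's formula at the centre, with the circle cut into its right and left halves so that
  the two halves can be estimated separately.\<close>

lemma cauchy_two_half_circles:
  fixes f :: "complex \<Rightarrow> complex"
  assumes "f holomorphic_on UNIV" "R > 0"
  shows "contour_integral (part_circlepath 0 R (-(pi/2)) (pi/2)) (\<lambda>z. f z / z) +
         contour_integral (part_circlepath 0 R (pi/2) (3*pi/2)) (\<lambda>z. f z / z) = 2 * pi * \<i> * f 0"
proof -
  define C1 where "C1 = part_circlepath 0 R (-(pi/2)) (pi/2)"
  define C2 where "C2 = part_circlepath 0 R (pi/2) (3*pi/2)"
  define q where "q = (\<lambda>z. if z = 0 then deriv f 0 else f z / z - f 0 / (z - 0))"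
  have nz: "0 \<notin> path_image (part_circlepath 0 R a b)" for a b
    using path_image_part_circlepath_subset'[of R 0 a b] assms(2) by auto
  have "q holomorphic_on UNIV"
    unfolding q_def using assms(1) by (intro pole_theorem) auto
  then have "(q has_contour_integral 0) (C1 +++ C2)"
  proof (rule Cauchy_theorem_convex_simple)
    have "exp (\<i> * of_real (3 * pi / 2)) = exp (\<i> * of_real (-(pi / 2)))"
      unfolding exp_eq by (intro exI[of _ 1]) (simp add: field_simps)
    then show "pathfinish (C1 +++ C2) = pathstart (C1 +++ C2)"
      by (simp add: C1_def C2_def)
  qed (auto simp: C1_def C2_def intro!: valid_path_join)
  moreover have "(q has_contour_integral (contour_integral C q)) C" if "C \<in> {C1, C2}" for C
    using that \<open>q holomorphic_on UNIV\<close>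
    by (auto simp: C1_def C2_def intro!: has_contour_integral_integral
        contour_integrable_continuous_part_circlepath holomorphic_on_imp_continuous_on
        intro: holomorphic_on_subset)
  ultimately have sum0: "contour_integral C1 q + contour_integral C2 q = 0"
    using has_contour_integral_unique[OF has_contour_integral_join[of q _ C1 _ C2]]
    by (simp add: C1_def C2_def)
  have half: "contour_integral (part_circlepath 0 R a (a + pi)) (\<lambda>z. f z / z) =
      contour_integral (part_circlepath 0 R a (a + pi)) q + pi * \<i> * f 0" for a
  proof -
    let ?C = "part_circlepath 0 R a (a + pi)"
    have "((\<lambda>z. f 0 / z) has_contour_integral (pi * \<i> * f 0)) ?C"
    proof (subst has_contour_integral_part_circlepath_iff)
      have "((\<lambda>t. \<i> * f 0) has_integral ((a + pi) - a) *\<^sub>R (\<i> * f 0)) {a..a + pi}"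
        using has_integral_const_real[of "\<i> * f 0" a "a + pi"] by simp
      then show "((\<lambda>t. f 0 / (0 + of_real R * cis t) * of_real R * \<i> * cis t) has_integral
          pi * \<i> * f 0) {a..a + pi}"
        using assms(2) by (simp add: scaleR_conv_of_real mult_ac)
    qed auto
    moreover have "(q has_contour_integral (contour_integral ?C q)) ?C"
      using \<open>q holomorphic_on UNIV\<close>
      by (auto intro!: has_contour_integral_integral
        contour_integrable_continuous_part_circlepath holomorphic_on_imp_continuous_on
        intro: holomorphic_on_subset)
    ultimately have "((\<lambda>z. q z + f 0 / z) has_contour_integral
        (contour_integral ?C q + pi * \<i> * f 0)) ?C"
      by (rule has_contour_integral_add[rotated])
    moreover have "q z + f 0 / z = f z / z" if "z \<in> path_image ?C" for z
      using that nz[of a "a + pi"] by (auto simp: q_def)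
    ultimately have "((\<lambda>z. f z / z) has_contour_integral
        (contour_integral ?C q + pi * \<i> * f 0)) ?C"
      by (rule has_contour_integral_eq)
    then show ?thesis
      by (rule contour_integral_unique)
  qed
  have "contour_integral C1 (\<lambda>z. f z / z) = contour_integral C1 q + pi * \<i> * f 0"
    using half[of "-(pi/2)"] by (simp add: C1_def)
  moreover have "contour_integral C2 (\<lambda>z. f z / z) = contour_integral C2 q + pi * \<i> * f 0"
    using half[of "pi/2"] by (simp add: C2_def)
  ultimately show ?thesis
    using sum0 unfolding C1_def [symmetric] C2_def [symmetric]
    by (simp add: algebra_simps add_eq_0_iff)
qed

text \<open>Regularity up to the imaginary axis suffices to replace the half circle by its diameter.\<close>

lemma cauchy_half_disc:
  fixes f :: "complex \<Rightarrow> complex"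
  assumes "\<And>z. Re z \<ge> 0 \<Longrightarrow> f field_differentiable at z" "R > 0"
  shows "contour_integral (part_circlepath 0 R (-(pi/2)) (pi/2)) f =
         contour_integral (linepath (-(\<i> * R)) (\<i> * R)) f"
proof -
  define C where "C = part_circlepath 0 R (-(pi/2)) (pi/2)"
  define S where "S = {z :: complex. Re z \<ge> 0}"
  have ends: "pathstart C = -(\<i> * R)" "pathfinish C = \<i> * R"
  proof -
    have "exp (\<i> * of_real (pi/2)) = \<i>" "exp (\<i> * of_real (-(pi/2))) = -\<i>"
      unfolding cis_conv_exp [symmetric] by simp_all
    then show "pathstart C = -(\<i> * R)" "pathfinish C = \<i> * R"
      unfolding C_def pathstart_part_circlepath pathfinish_part_circlepath by simp_all
  qed
  have S: "convex S"
    unfolding S_def by (rule convex_halfspace_Re_ge)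
  have sub: "path_image C \<subseteq> S" "closed_segment (\<i> * R) (-(\<i> * R)) \<subseteq> S"
  proof -
    show "path_image C \<subseteq> S"
      unfolding C_def path_image_part_circlepath' S_def using assms(2)
      by (auto simp: closed_segment_eq_real_ivl cos_ge_zero)
    show "closed_segment (\<i> * R) (-(\<i> * R)) \<subseteq> S"
      by (rule closed_segment_subset[OF _ _ S]) (auto simp: S_def)
  qed
  have hol: "f holomorphic_on S"
    using assms(1) by (auto simp: S_def holomorphic_on_def intro: field_differentiable_at_within)
  have "(f has_contour_integral 0) (C +++ linepath (\<i> * R) (-(\<i> * R)))"
    by (rule Cauchy_theorem_convex_simple[OF hol S])
       (use ends sub in \<open>auto simp: path_image_join C_def intro!: valid_path_join\<close>)
  moreover have "f contour_integrable_on C"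
    unfolding C_def
    by (rule contour_integrable_continuous_part_circlepath)
       (use hol sub in \<open>auto simp: C_def intro: holomorphic_on_imp_continuous_on holomorphic_on_subset\<close>)
  moreover have int: "f contour_integrable_on linepath (\<i> * R) (-(\<i> * R))"
    by (rule contour_integrable_continuous_linepath)
       (use hol sub in \<open>auto intro: holomorphic_on_imp_continuous_on holomorphic_on_subset\<close>)
  moreover have "contour_integral (C +++ linepath (\<i> * R) (-(\<i> * R))) f =
      contour_integral C f + contour_integral (linepath (\<i> * R) (-(\<i> * R))) f"
    using calculation by (intro contour_integral_join) (simp_all add: C_def)
  ultimately have "contour_integral C f + contour_integral (linepath (\<i> * R) (-(\<i> * R))) f = 0"
    using contour_integral_unique by metis
  moreover have "contour_integral (linepath (\<i> * R) (-(\<i> * R))) f =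
      - contour_integral (linepath (-(\<i> * R)) (\<i> * R)) f"
    by (metis contour_integral_reversepath reversepath_linepath valid_path_linepath minus_minus)
  ultimately show ?thesis
    by (simp add: C_def)
qed

text \<open>On the diameter \<open>N\<^sup>z\<close> is a pure oscillation of frequency \<open>ln N\<close>, and the factor
  \<open>1 + z\<^sup>2/R\<^sup>2\<close> vanishes at both end points, as \<open>riemann_lebesgue\<close> requires.\<close>

lemma oscillating_segment_integral_tendsto_0:
  fixes H :: "complex \<Rightarrow> complex"
  assumes H: "\<And>z. Re z \<ge> 0 \<Longrightarrow> H field_differentiable at z" and "R > 0"
  shows "(\<lambda>N. contour_integral (linepath (-(\<i> * of_real R)) (\<i> * of_real R))
           (\<lambda>z. H z * (of_nat N powr z * (1 + z\<^sup>2 / of_real (R\<^sup>2))))) \<longlonglongrightarrow> 0"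
proof (rule Lim_null_comparison)
  define h where "h = (\<lambda>x. H (\<i> * of_real (R * (2 * x - 1))) * of_real (1 - (2 * x - 1)\<^sup>2))"
  define I where "I = (\<lambda>\<omega>. integral {0..1} (\<lambda>x. h x * cis (\<omega> * x)))"
  have "continuous_on {z. Re z \<ge> 0} H"
    using H by (auto simp: continuous_on_eq_continuous_within
        intro: field_differentiable_imp_continuous_at continuous_at_imp_continuous_at_within)
  then have "continuous_on {0..1} (\<lambda>x. H (\<i> * of_real (R * (2 * x - 1))))"
    by (rule continuous_on_compose2) (auto intro!: continuous_intros)
  then have "continuous_on {0..1} h"
    unfolding h_def by (intro continuous_intros)
  then have I: "(I \<longlongrightarrow> 0) at_top"
    unfolding I_def by (rule riemann_lebesgue) (auto simp: h_def)
  have "filterlim (\<lambda>N. 2 * R * ln (real N)) at_top sequentially"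
    using \<open>R > 0\<close> by real_asymp
  from filterlim_compose[OF I this]
  show "(\<lambda>N. 2 * R * norm (I (2 * R * ln (real N)))) \<longlonglongrightarrow> 0"
    by (intro tendsto_mult_right_zero tendsto_norm_zero)
  show "\<forall>\<^sub>F N in sequentially. norm (contour_integral (linepath (-(\<i> * of_real R)) (\<i> * of_real R))
           (\<lambda>z. H z * (of_nat N powr z * (1 + z\<^sup>2 / of_real (R\<^sup>2)))))
        \<le> 2 * R * norm (I (2 * R * ln (real N)))"
    using eventually_ge_at_top[of 1]
  proof eventually_elim
    case (elim N)
    define l where "l = ln (real N)"
    have "contour_integral (linepath (-(\<i> * of_real R)) (\<i> * of_real R))
           (\<lambda>z. H z * (of_nat N powr z * (1 + z\<^sup>2 / of_real (R\<^sup>2)))) =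
        integral {0..1} (\<lambda>x. (cis (- R * l) * (2 * \<i> * of_real R)) * (h x * cis (2 * R * l * x)))"
      unfolding contour_integral_integral
    proof (rule integral_cong)
      fix x :: real
      define z where "z = linepath (-(\<i> * of_real R)) (\<i> * of_real R) x"
      have z: "z = \<i> * of_real (R * (2 * x - 1))"
        by (simp add: z_def linepath_def scaleR_conv_of_real algebra_simps)
      have "of_nat N powr z = cis (l * (R * (2 * x - 1)))"
        using elim by (simp add: powr_def z l_def cis_conv_exp mult_ac)
      also have "l * (R * (2 * x - 1)) = - R * l + 2 * R * l * x"
        by (simp add: algebra_simps)
      finally have powr: "of_nat N powr z = cis (- R * l) * cis (2 * R * l * x)"
        by (simp only: cis_mult)
      have "1 + z\<^sup>2 / of_real (R\<^sup>2) = of_real (1 - (2 * x - 1)\<^sup>2)"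
        using \<open>R > 0\<close> by (simp add: z power_mult_distrib)
      then show "H (linepath (-(\<i> * of_real R)) (\<i> * of_real R) x) *
          (of_nat N powr linepath (-(\<i> * of_real R)) (\<i> * of_real R) x *
           (1 + (linepath (-(\<i> * of_real R)) (\<i> * of_real R) x)\<^sup>2 / of_real (R\<^sup>2))) *
          vector_derivative (linepath (-(\<i> * of_real R)) (\<i> * of_real R)) (at x) =
        (cis (- R * l) * (2 * \<i> * of_real R)) * (h x * cis (2 * R * l * x))"
        unfolding z_def [symmetric] powr h_def z [symmetric] vector_derivative_linepath_at
        by simp
    qed
    also have "\<dots> = (cis (- R * l) * (2 * \<i> * of_real R)) * I (2 * R * l)"
      by (simp add: I_def)
    finally show ?case
      using \<open>R > 0\<close> by (simp add: norm_mult l_def)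
  qed
qed

text \<open>Newman's kernel is real on the circle and vanishes to first order at the imaginary axis.\<close>

lemma newman_kernel_on_circle:
  assumes "norm z = R" "R > 0"
  shows "(1 + z\<^sup>2 / of_real (R\<^sup>2)) / z = of_real (2 * Re z / R\<^sup>2)"
proof -
  have "z * cnj z = of_real (R\<^sup>2)"
    using assms complex_norm_square[of z] by simp
  then have "z * (2 * of_real (Re z)) = of_real (R\<^sup>2) + z\<^sup>2"
    by (simp add: complex_eq_iff power2_eq_square algebra_simps)
  moreover have r: "of_real (R\<^sup>2) \<noteq> (0 :: complex)"
    using assms by simp
  then have "1 + z\<^sup>2 / of_real (R\<^sup>2) = (of_real (R\<^sup>2) + z\<^sup>2) / of_real (R\<^sup>2)"
    by (simp add: add_divide_distrib)
  ultimately have "1 + z\<^sup>2 / of_real (R\<^sup>2) = z * (2 * of_real (Re z)) / of_real (R\<^sup>2)"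
    by (simp only:)
  moreover have "z \<noteq> 0"
    using assms by auto
  ultimately show ?thesis
    by simp
qed

text \<open>Cauchy's formula represents the partial sum \<open>S(0)\<close> by the integral of \<open>S(z) N\<^sup>z\<close> against
  the kernel over the circle of radius \<open>R\<close>. On the right half \<open>S\<close> is split into the full series
  \<open>z H(z)\<close>, which is moved to the diameter, and a tail of size at most \<open>N\<^sup>-\<^sup>x/x\<close> with
  \<open>x = Re z\<close>; on the left half \<open>S\<close> has size about \<open>N\<^sup>y/y\<close> with \<open>y = -Re z\<close>. In both
  estimates \<open>N\<^sup>z\<close> and the kernel \<open>2 Re z / R\<^sup>2\<close> cancel the growth and the singularity at
  \<open>Re z = 0\<close>; up to a term that vanishes as \<open>N\<close> grows, \<open>2/R\<^sup>2\<close> remains on an arc of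
  length \<open>\<pi> R\<close>.\<close>

lemma newman_partial_sum_bound:
  fixes a :: "nat \<Rightarrow> complex"
  assumes a: "\<And>n. norm (a n) \<le> 1" and R: "R > 0" and N: "N \<ge> 1"
    and H: "\<And>z. Re z \<ge> 0 \<Longrightarrow> H field_differentiable at z"
    and eq: "\<And>z. Re z > 0 \<Longrightarrow> (\<Sum>n. a n * of_nat n powr -(1 + z)) = z * H z"
  shows "norm (\<Sum>n=1..N. a n / of_nat n) \<le> 2 / R + 1 / real N +
          norm (contour_integral (linepath (-(\<i> * of_real R)) (\<i> * of_real R))
           (\<lambda>z. H z * (of_nat N powr z * (1 + z\<^sup>2 / of_real (R\<^sup>2))))) / (2 * pi)"
proof -
  define S where "S = (\<lambda>z. \<Sum>n=1..N. a n * of_nat n powr -(1 + z))"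
  define g where "g = (\<lambda>z. of_nat N powr z * (1 + z\<^sup>2 / of_real (R\<^sup>2)) :: complex)"
  define C1 where "C1 = part_circlepath 0 R (-(pi/2)) (pi/2)"
  define C2 where "C2 = part_circlepath 0 R (pi/2) (3*pi/2)"
  define T where "T = contour_integral (linepath (-(\<i> * of_real R)) (\<i> * of_real R)) (\<lambda>z. H z * g z)"
  have S0: "S 0 = (\<Sum>n=1..N. a n / of_nat n)"
    by (simp add: S_def powr_minus divide_inverse)
  have g: "g holomorphic_on UNIV"
    unfolding g_def using R by (intro holomorphic_intros) auto
  have Sg: "(\<lambda>z. S z * g z) holomorphic_on UNIV"
    unfolding S_def by (intro holomorphic_intros g)
  have g_cont: "continuous_on A g" and Sg_cont: "continuous_on A (\<lambda>z. S z * g z)" for A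
    using holomorphic_on_imp_continuous_on[OF holomorphic_on_subset[OF g]]
      holomorphic_on_imp_continuous_on[OF holomorphic_on_subset[OF Sg]] by simp_all
  have img1: "norm z = R" "Re z \<ge> 0" "z \<noteq> 0" if "z \<in> path_image C1" for z
    using that R unfolding C1_def path_image_part_circlepath'
    by (auto simp: closed_segment_eq_real_ivl cos_ge_zero norm_mult)
  have img2: "norm z = R" "Re z \<le> 0" "z \<noteq> 0" if z: "z \<in> path_image C2" for z
  proof -
    have "z \<in> (\<lambda>t. 0 + of_real R * cis t) ` {pi/2..3*pi/2}"
      using z unfolding C2_def path_image_part_circlepath' by (simp add: closed_segment_eq_real_ivl)
    then obtain t where "t \<in> {pi/2..3*pi/2}" "z = 0 + of_real R * cis t"
      by blast
    then have t: "z = R * cis t" "pi/2 \<le> t" "t \<le> 3*pi/2"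
      by auto
    have "cos (t - pi) \<ge> 0"
      using t by (intro cos_ge_zero) auto
    then have "cos t \<le> 0"
      by simp
    then show "norm z = R" "Re z \<le> 0" "z \<noteq> 0"
      using t R by (auto simp: norm_mult mult_nonneg_nonpos)
  qed
  have kernel: "g z / z = of_nat N powr z * of_real (2 * Re z / R\<^sup>2)" if "norm z = R" for z
  proof -
    have "g z / z = of_nat N powr z * ((1 + z\<^sup>2 / of_real (R\<^sup>2)) / z)"
      by (simp add: g_def)
    then show ?thesis
      by (simp only: newman_kernel_on_circle[OF that R])
  qed
  have norm_a_le: "norm (a n * of_nat n powr -(1 + z)) \<le> real n powr -(1 + Re z)" for n z
    using mult_right_mono[OF a[of n], of "real n powr -(1 + Re z)"]
    by (simp add: norm_mult norm_nat_powr)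

  have "norm (contour_integral C2 (\<lambda>z. S z * g z / z)) \<le> (2 / R\<^sup>2 + 2 / (real N * R)) * R * (3*pi/2 - pi/2)"
  proof (rule contour_integral_bound_part_circlepath_strong[of "\<lambda>z. S z * g z / z" 0 R "pi/2" "3*pi/2" "{}", folded C2_def])
    show "(\<lambda>z. S z * g z / z) contour_integrable_on C2"
      unfolding C2_def using img2(3)
      by (intro contour_integrable_continuous_part_circlepath continuous_on_divide Sg_cont
          continuous_on_id) (auto simp: C2_def)
    fix z assume "z \<in> path_image C2 - {}"
    then have z: "norm z = R" "Re z \<le> 0" "z \<noteq> 0"
      using img2 by auto
    define y where "y = - Re z"
    have y: "0 \<le> y" "y \<le> R"
      using z abs_Re_le_cmod[of z] by (auto simp: y_def)
    show "norm (S z * g z / z) \<le> 2 / R\<^sup>2 + 2 / (real N * R)"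
    proof (cases "y = 0")
      case True
      then have "g z / z = 0"
        using kernel[OF z(1)] by (simp add: y_def)
      then show ?thesis
        using R z by simp
    next
      case False
      have y_eq: "-(1 + Re z) = y - 1"
        by (simp add: y_def)
      have "norm (S z) \<le> (\<Sum>n=1..N. real n powr (y - 1))"
        unfolding S_def y_eq [symmetric] by (intro sum_norm_le norm_a_le)
      also have "(\<Sum>n=1..N. real n powr (y - 1)) \<le> real N powr y / y + real N powr (y - 1)"
        using False y N by (intro sum_powr_le) auto
      finally have S_le: "norm (S z) \<le> real N powr y / y + real N powr (y - 1)" .
      have "S z * g z / z = S z * (of_nat N powr z * of_real (2 * Re z / R\<^sup>2))"
        unfolding kernel[OF z(1), symmetric] by simp
      also have "norm \<dots> = norm (S z) * (real N powr -y * (2 * y / R\<^sup>2))"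
        unfolding norm_mult norm_nat_powr norm_of_real using z(2) by (simp add: y_def)
      finally have "norm (S z * g z / z) = norm (S z) * (real N powr -y * (2 * y / R\<^sup>2))" .
      also have "norm (S z) * (real N powr -y * (2 * y / R\<^sup>2))
          \<le> (real N powr y / y + real N powr (y - 1)) * (real N powr -y * (2 * y / R\<^sup>2))"
        using y by (intro mult_right_mono S_le) auto
      also have "\<dots> = 2 / R\<^sup>2 + 2 * y / (real N * R\<^sup>2)"
        using False N R by (simp add: powr_diff powr_minus field_simps)
      also have "2 * y / (real N * R\<^sup>2) \<le> 2 * R / (real N * R\<^sup>2)"
        using y by (intro divide_right_mono) auto
      also have "2 * R / (real N * R\<^sup>2) = 2 / (real N * R)"
        using R by (simp add: power2_eq_square)
      finally show ?thesis
        by simp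
    qed
  qed (use R in auto)
  also have "(2 / R\<^sup>2 + 2 / (real N * R)) * R * (3*pi/2 - pi/2) = 2 * pi / R + 2 * pi / real N"
    using R N by (simp add: field_simps power2_eq_square)
  finally have left: "norm (contour_integral C2 (\<lambda>z. S z * g z / z)) \<le> 2 * pi / R + 2 * pi / real N" .

  define D where "D = (\<lambda>z. S z * g z / z - H z * g z)"
  have Hcont: "continuous_on (path_image C1) H"
    by (intro continuous_at_imp_continuous_on ballI field_differentiable_imp_continuous_at H img1)
  have int1: "(\<lambda>z. S z * g z / z) contour_integrable_on C1"
    unfolding C1_def using img1(3)
    by (intro contour_integrable_continuous_part_circlepath continuous_on_divide Sg_cont
        continuous_on_id) (auto simp: C1_def)
  have int2: "(\<lambda>z. H z * g z) contour_integrable_on C1"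
    unfolding C1_def
    by (intro contour_integrable_continuous_part_circlepath continuous_on_mult
        Hcont[unfolded C1_def] g_cont)
  have "norm (contour_integral C1 D) \<le> 2 / R\<^sup>2 * R * (pi/2 - (-(pi/2)))"
  proof (rule contour_integral_bound_part_circlepath_strong[of D 0 R "-(pi/2)" "pi/2" "{}", folded C1_def])
    show "D contour_integrable_on C1"
      unfolding D_def by (intro contour_integrable_diff int1 int2)
    fix z assume "z \<in> path_image C1 - {}"
    then have z: "norm z = R" "Re z \<ge> 0" "z \<noteq> 0"
      using img1 by auto
    show "norm (D z) \<le> 2 / R\<^sup>2"
    proof (cases "Re z = 0")
      case True
      then have "g z / z = 0"
        using kernel[OF z(1)] by simp
      then have "g z = 0"
        using z by simp
      then show ?thesis
        by (simp add: D_def)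
    next
      case False
      define x where "x = Re z"
      have x: "x > 0"
        using False z by (simp add: x_def)
      have summable: "summable (\<lambda>n. a n * of_nat n powr -(1 + z))"
        using summable_norm_bounded_nat_powr[of "1 + z" a] a x
        by (auto simp: x_def dest: summable_norm_cancel)
      have "{..<Suc N} = insert 0 {1..N}"
        by auto
      then have "z * H z = (\<Sum>n. a (n + Suc N) * of_nat (n + Suc N) powr -(1 + z)) + S z"
        using eq[of z] x suminf_split_initial_segment[OF summable, of "Suc N"]
        by (simp add: x_def S_def)
      then have "norm (S z - z * H z) = norm (\<Sum>n. a (n + Suc N) * of_nat (n + Suc N) powr -(1 + z))"
        by simp
      also have "\<dots> \<le> (\<Sum>n. real (n + Suc N) powr -(1 + x))"
        unfolding x_def
        by (rule norm_suminf_le[OF norm_a_le])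
           (use suminf_powr_tail_le(1)[OF x N] in \<open>simp add: x_def\<close>)
      also have "\<dots> \<le> real N powr -x / x"
        by (rule suminf_powr_tail_le(2)[OF x N])
      finally have le: "norm (S z - z * H z) \<le> real N powr -x / x" .
      have "D z = (S z - z * H z) * (g z / z)"
        using z by (simp add: D_def field_simps)
      also have "norm \<dots> = norm (S z - z * H z) * (real N powr x * (2 * x / R\<^sup>2))"
        unfolding kernel[OF z(1)] norm_mult norm_nat_powr norm_of_real using x by (simp add: x_def)
      finally have "norm (D z) = norm (S z - z * H z) * (real N powr x * (2 * x / R\<^sup>2))" .
      also have "\<dots> \<le> (real N powr -x / x) * (real N powr x * (2 * x / R\<^sup>2))"
        using x by (intro mult_right_mono le) auto
      also have "\<dots> = 2 / R\<^sup>2"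
        using x N R by (simp add: powr_minus field_simps)
      finally show ?thesis .
    qed
  qed (use R in auto)
  also have "2 / R\<^sup>2 * R * (pi/2 - (-(pi/2))) = 2 * pi / R"
    using R by (simp add: field_simps power2_eq_square)
  finally have right: "norm (contour_integral C1 D) \<le> 2 * pi / R" .

  have "contour_integral C1 D = contour_integral C1 (\<lambda>z. S z * g z / z) - contour_integral C1 (\<lambda>z. H z * g z)"
    unfolding D_def by (intro contour_integral_diff int1 int2)
  moreover have "contour_integral C1 (\<lambda>z. H z * g z) = T"
    unfolding C1_def T_def using g
    by (intro cauchy_half_disc derivative_intros H R)
       (auto simp: holomorphic_on_imp_differentiable_at)
  moreover have "contour_integral C1 (\<lambda>z. S z * g z / z) + contour_integral C2 (\<lambda>z. S z * g z / z) =
      2 * pi * \<i> * (S 0 * g 0)"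
    unfolding C1_def C2_def by (rule cauchy_two_half_circles[OF Sg R])
  moreover have "g 0 = 1"
    using N by (simp add: g_def)
  ultimately have "2 * pi * \<i> * S 0 = contour_integral C1 D + T + contour_integral C2 (\<lambda>z. S z * g z / z)"
    by simp
  then have "norm (2 * pi * \<i> * S 0) \<le> norm (contour_integral C1 D) + norm T +
      norm (contour_integral C2 (\<lambda>z. S z * g z / z))"
    by (simp only:) (intro norm_triangle_mono order_refl)
  then have "2 * pi * norm (S 0) \<le> 2 * pi / R + norm T + (2 * pi / R + 2 * pi / real N)"
    using left right by (simp add: norm_mult)
  then have "norm (S 0) \<le> (2 * pi / R + norm T + (2 * pi / R + 2 * pi / real N)) / (2 * pi)"
    by (simp add: field_simps)
  also have "\<dots> = 2 / R + 1 / real N + norm T / (2 * pi)"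
    by (simp add: add_divide_distrib)
  finally show ?thesis
    by (simp add: S0 T_def g_def)
qed

text \<open>Writing the series as \<open>z H(z)\<close> builds in that it vanishes at \<open>0\<close>, which cancels the pole
  of the kernel on the diameter. The radius \<open>R\<close> in \<open>newman_partial_sum_bound\<close> is free: \<open>N\<close> is
  sent to infinity first, and \<open>R\<close> afterwards.\<close>

theorem newman_tauberian:
  fixes a :: "nat \<Rightarrow> complex"
  assumes a: "\<And>n. norm (a n) \<le> 1"
    and H: "\<And>z. Re z \<ge> 0 \<Longrightarrow> H field_differentiable at z"
    and eq: "\<And>z. Re z > 0 \<Longrightarrow> (\<Sum>n. a n * of_nat n powr -(1 + z)) = z * H z"
  shows "(\<lambda>N. \<Sum>n=1..N. a n / of_nat n) \<longlonglongrightarrow> 0"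
proof (rule tendstoI)
  fix e :: real assume "e > 0"
  define R where "R = 4 / e"
  have "R > 0" "2 / R < e"
    using \<open>e > 0\<close> by (auto simp: R_def)
  define T where "T = (\<lambda>N. contour_integral (linepath (-(\<i> * of_real R)) (\<i> * of_real R))
           (\<lambda>z. H z * (of_nat N powr z * (1 + z\<^sup>2 / of_real (R\<^sup>2)))))"
  have T: "T \<longlonglongrightarrow> 0"
    unfolding T_def by (rule oscillating_segment_integral_tendsto_0[OF H \<open>R > 0\<close>])
  have "(\<lambda>N. 2 / R + 1 / real N + norm (T N) / (2 * pi)) \<longlonglongrightarrow> 2 / R + 0 + norm (0 :: complex) / (2 * pi)"
    by (intro tendsto_intros T lim_1_over_n) auto
  then have "\<forall>\<^sub>F N in sequentially. 2 / R + 1 / real N + norm (T N) / (2 * pi) < e"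
    using \<open>2 / R < e\<close> by (intro order_tendstoD(2)) auto
  then show "\<forall>\<^sub>F N in sequentially. dist (\<Sum>n=1..N. a n / of_nat n) 0 < e"
    using eventually_ge_at_top[of 1]
  proof eventually_elim
    case (elim N)
    then show ?case
      using newman_partial_sum_bound[OF a \<open>R > 0\<close> _ H eq, of N] by (simp add: T_def)
  qed
qed

section \<open>Mean values\<close>

lemma initial_segment_eq: "{n :: nat. 1 \<le> n \<and> real n \<le> x} = {1..nat \<lfloor>x\<rfloor>}"
  by (auto simp: le_nat_floor le_floor_iff nat_le_iff) linarith+

lemma norm_average: "x > 0 \<Longrightarrow> norm (v /\<^sub>R x) = norm v / x"
  by (simp add: field_simps)

lemma has_mean_valueI_nat:
  assumes "(\<lambda>N. (\<Sum>n=1..N. f n) /\<^sub>R real N) \<longlonglongrightarrow> m"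
  shows "has_mean_value f m"
proof -
  define S where "S = (\<lambda>N. (\<Sum>n=1..N. f n) /\<^sub>R real N)"
  have floor: "filterlim (\<lambda>x :: real. nat \<lfloor>x\<rfloor>) sequentially at_top"
    by (intro filterlim_compose[OF filterlim_nat_sequentially filterlim_floor_sequentially])
  have "((\<lambda>x :: real. (real (nat \<lfloor>x\<rfloor>) / x) *\<^sub>R S (nat \<lfloor>x\<rfloor>)) \<longlongrightarrow> 1 *\<^sub>R m) at_top"
  proof (intro tendsto_scaleR filterlim_compose[OF _ floor])
    show "S \<longlonglongrightarrow> m"
      using assms by (simp add: S_def)
    show "((\<lambda>x :: real. real (nat \<lfloor>x\<rfloor>) / x) \<longlongrightarrow> 1) at_top"
      by real_asymp
  qed
  moreover have "\<forall>\<^sub>F x in at_top. (real (nat \<lfloor>x\<rfloor>) / x) *\<^sub>R S (nat \<lfloor>x\<rfloor>) =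
      (\<Sum>n | 1 \<le> n \<and> real n \<le> x. f n) /\<^sub>R x"
    using eventually_ge_at_top[of "1 :: real"]
  proof eventually_elim
    case (elim x)
    then have "nat \<lfloor>x\<rfloor> \<noteq> 0"
      by linarith
    then show ?case
      unfolding S_def initial_segment_eq using elim by (simp add: field_simps)
  qed
  ultimately show ?thesis
    unfolding has_mean_value_def by (simp add: tendsto_cong)
qed

lemma has_mean_value_add:
  assumes "has_mean_value f a" "has_mean_value g b"
  shows "has_mean_value (\<lambda>n. f n + g n) (a + b)"
  using tendsto_add[OF assms[unfolded has_mean_value_def]]
  by (simp add: has_mean_value_def sum.distrib scaleR_add_right)

lemma has_mean_value_cmult:
  fixes f :: "nat \<Rightarrow> 'a :: real_normed_algebra"
  assumes "has_mean_value f a"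
  shows "has_mean_value (\<lambda>n. c * f n) (c * a)"
  using tendsto_mult[OF tendsto_const[of c] assms[unfolded has_mean_value_def]]
  by (simp add: has_mean_value_def sum_distrib_left)

lemma has_mean_value_diff:
  fixes f :: "nat \<Rightarrow> 'a :: real_normed_algebra_1"
  assumes "has_mean_value f a" "has_mean_value g b"
  shows "has_mean_value (\<lambda>n. f n - g n) (a - b)"
  using has_mean_value_add[OF assms(1) has_mean_value_cmult[OF assms(2), of "-1"]] by simp

lemma has_mean_value_0: "has_mean_value (\<lambda>n. 0) 0"
  by (simp add: has_mean_value_def)

lemma has_mean_value_sum:
  assumes "\<And>i. i \<in> I \<Longrightarrow> has_mean_value (f i) (m i)"
  shows "has_mean_value (\<lambda>n. \<Sum>i\<in>I. f i n) (\<Sum>i\<in>I. m i)"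
  using assms
  by (induction I rule: infinite_finite_induct) (auto intro: has_mean_value_0 has_mean_value_add)

lemma has_mean_value_of_real:
  assumes "has_mean_value f m"
  shows "has_mean_value (\<lambda>n. of_real (f n) :: 'a :: real_normed_algebra_1) (of_real m)"
  using tendsto_of_real[OF assms[unfolded has_mean_value_def], where 'a = 'a]
  by (simp add: has_mean_value_def scaleR_conv_of_real)

text \<open>Cesaro's theorem: all but finitely many terms are small, and the weight of the others
  tends to \<open>0\<close>.\<close>

lemma has_mean_value_tendsto_0:
  fixes f :: "nat \<Rightarrow> 'a :: real_normed_vector"
  assumes "f \<longlonglongrightarrow> 0"
  shows "has_mean_value f 0"
proof (rule has_mean_valueI_nat, rule tendstoI)
  fix e :: real assume "e > 0"
  then obtain K where K: "\<And>n. n \<ge> K \<Longrightarrow> norm (f n) < e / 2"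
    using LIMSEQ_D[OF assms, of "e / 2"] by auto
  define B where "B = (\<Sum>n=1..K. norm (f n))"
  have "(\<lambda>N. B / real N + e / 2) \<longlonglongrightarrow> 0 + e / 2"
    by (intro tendsto_intros lim_const_over_n)
  then have "\<forall>\<^sub>F N in sequentially. B / real N + e / 2 < e"
    by (rule order_tendstoD(2)) (use \<open>e > 0\<close> in simp)
  then show "\<forall>\<^sub>F N in sequentially. dist ((\<Sum>n=1..N. f n) /\<^sub>R real N) 0 < e"
    using eventually_ge_at_top[of 1]
  proof eventually_elim
    case (elim N)
    have "norm (\<Sum>n=1..N. f n) \<le> (\<Sum>n=1..N. norm (f n))"
      by (rule norm_sum)
    also have "\<dots> \<le> (\<Sum>n=1..N. (if n \<le> K then norm (f n) else 0) + e / 2)"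
      using K \<open>e > 0\<close> by (intro sum_mono) (auto simp: less_imp_le)
    also have "\<dots> = (\<Sum>n\<in>{n\<in>{1..N}. n \<le> K}. norm (f n)) + real N * e / 2"
      unfolding sum.distrib sum.inter_filter[OF finite_atLeastAtMost] by simp
    also have "(\<Sum>n\<in>{n\<in>{1..N}. n \<le> K}. norm (f n)) \<le> B"
      unfolding B_def by (intro sum_mono2) auto
    finally have "norm (\<Sum>n=1..N. f n) / real N \<le> (B + real N * e / 2) / real N"
      by (intro divide_right_mono) auto
    also have "\<dots> = B / real N + e / 2"
      using elim by (simp add: field_simps)
    finally show ?case
      using elim norm_average[of "real N" "\<Sum>n=1..N. f n"] unfolding dist_norm diff_0_right by linarith
  qed
qed

lemma has_mean_value_cong:
  assumes "has_mean_value f m" "\<And>n. n \<ge> K \<Longrightarrow> f n = g n"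
  shows "has_mean_value g m"
proof -
  have "(\<lambda>n. g n - f n) \<longlonglongrightarrow> 0"
    using assms(2) by (intro tendsto_eventually eventually_sequentiallyI[of K]) simp
  from has_mean_value_add[OF assms(1) has_mean_value_tendsto_0[OF this]] show ?thesis
    by simp
qed

lemma has_mean_value_1: "has_mean_value (\<lambda>n. 1 :: real) 1"
proof (rule has_mean_valueI_nat)
  show "(\<lambda>N. (\<Sum>n=1..N. 1) /\<^sub>R real N) \<longlonglongrightarrow> (1 :: real)"
    by (rule tendsto_eventually, rule eventually_sequentiallyI[of 1]) simp
qed

lemma has_mean_value_dilate:
  assumes "has_mean_value f m" "q > 0"
  shows "has_mean_value (\<lambda>n. if q dvd n then f (n div q) else 0) (m /\<^sub>R real q)"
proof -
  define A where "A = (\<lambda>x :: real. {n :: nat. 1 \<le> n \<and> real n \<le> x})"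
  have fin: "finite (A x)" for x
    unfolding A_def initial_segment_eq by simp
  have "filterlim (\<lambda>x :: real. x / real q) at_top at_top"
    using assms(2) by real_asymp
  from filterlim_compose[OF assms(1)[unfolded has_mean_value_def] this]
  have "((\<lambda>x. ((\<Sum>n\<in>A (x / real q). f n) /\<^sub>R (x / real q)) /\<^sub>R real q) \<longlongrightarrow> m /\<^sub>R real q) at_top"
    unfolding A_def by (intro tendsto_intros)
  moreover have "((\<Sum>n\<in>A (x / real q). f n) /\<^sub>R (x / real q)) /\<^sub>R real q =
      (\<Sum>n\<in>A x. if q dvd n then f (n div q) else 0) /\<^sub>R x" for x
  proof -
    have "(\<Sum>n\<in>A x. if q dvd n then f (n div q) else 0) = (\<Sum>n\<in>{n\<in>A x. q dvd n}. f (n div q))"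
      using fin by (simp add: sum.inter_filter)
    also have "\<dots> = (\<Sum>n\<in>A (x / real q). f n)"
      using assms(2)
      by (intro sum.reindex_bij_witness[of _ "\<lambda>n. q * n" "\<lambda>n. n div q"])
         (auto simp: A_def field_simps elim!: dvdE)
    finally show ?thesis
      using assms(2) by (simp add: field_simps)
  qed
  ultimately show ?thesis
    by (simp add: has_mean_value_def A_def)
qed

text \<open>The error \<open>\<delta> N\<close> is uniform in the range of averaging, so the mean value of \<open>f\<close> is within
  \<open>\<delta> N\<close> of \<open>m N\<close> in the limit for each fixed \<open>N\<close>, and \<open>N\<close> may grow afterwards.\<close>

lemma has_mean_value_approx:
  fixes f :: "nat \<Rightarrow> 'a :: real_normed_vector"
  assumes mean: "\<And>N. has_mean_value (g N) (m N)" and m: "m \<longlonglongrightarrow> l" and \<delta>: "\<delta> \<longlonglongrightarrow> 0"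
    and le: "\<And>N X. norm (\<Sum>n=1..X. g N n - f n) \<le> \<delta> N * real X"
  shows "has_mean_value f l"
  unfolding has_mean_value_def
proof (rule tendstoI)
  fix e :: real assume "e > 0"
  define avg where "avg = (\<lambda>h :: nat \<Rightarrow> 'a. \<lambda>x :: real. (\<Sum>n | 1 \<le> n \<and> real n \<le> x. h n) /\<^sub>R x)"
  have "\<forall>\<^sub>F N in sequentially. \<delta> N < e / 3 \<and> dist (m N) l < e / 3"
    using \<open>e > 0\<close> by (intro eventually_conj order_tendstoD(2)[OF \<delta>] tendstoD[OF m]) simp_all
  from eventually_happens'[OF sequentially_bot this]
  obtain N where N: "\<delta> N < e / 3" "dist (m N) l < e / 3"
    by blast
  have "(avg (g N) \<longlongrightarrow> m N) at_top"
    using mean[of N] by (simp add: has_mean_value_def avg_def)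
  then have "\<forall>\<^sub>F x in at_top. dist (avg (g N) x) (m N) < e / 3"
    using \<open>e > 0\<close> by (intro tendstoD) auto
  then show "\<forall>\<^sub>F x in at_top. dist (avg f x) l < e"
    using eventually_gt_at_top[of 0]
  proof eventually_elim
    case (elim x)
    have "avg (g N) x - avg f x = (\<Sum>n=1..nat \<lfloor>x\<rfloor>. g N n - f n) /\<^sub>R x"
      unfolding avg_def initial_segment_eq by (simp add: sum_subtractf scaleR_diff_right)
    then have "dist (avg (g N) x) (avg f x) = norm (\<Sum>n=1..nat \<lfloor>x\<rfloor>. g N n - f n) / x"
      unfolding dist_norm using norm_average[OF elim(2)] by (simp only:)
    also have "\<dots> \<le> e / 3 * x / x"
    proof (intro divide_right_mono)
      have "norm (\<Sum>n=1..nat \<lfloor>x\<rfloor>. g N n - f n) \<le> \<delta> N * real (nat \<lfloor>x\<rfloor>)"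
        by (rule le)
      also have "\<dots> \<le> e / 3 * x"
        using N \<open>e > 0\<close> elim by (intro mult_mono) linarith+
      finally show "norm (\<Sum>n=1..nat \<lfloor>x\<rfloor>. g N n - f n) \<le> e / 3 * x" .
    qed (use elim in auto)
    finally have "dist (avg (g N) x) (avg f x) \<le> e / 3"
      using elim by simp
    then show ?case
      using elim N dist_triangle[of "avg f x" l "avg (g N) x"] dist_triangle[of "avg (g N) x" l "m N"]
        dist_commute[of "avg f x" "avg (g N) x"] by linarith
  qed
qed

text \<open>This has the strength of the prime number theorem. The Euler factors at \<open>B\<close> have neither
  zeros nor poles for \<open>Re z \<ge> 0\<close>, so removing them from \<open>\<zeta>\<close> preserves what \<open>newman_tauberian\<close>
  needs, and \<open>\<Sum> \<mu>(n)/n = 0\<close> holds over the integers prime to \<open>B\<close> as well.\<close>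

theorem has_mean_value_moebius_away:
  assumes "finite B" "\<And>p. p \<in> B \<Longrightarrow> prime p"
  shows "has_mean_value (\<lambda>n. of_int (moebius_away B n) :: complex) 0"
proof -
  define a where "a = (\<lambda>n. of_int (moebius_away B n) :: complex)"
  define E where "E = (\<lambda>z :: complex. \<Prod>p\<in>B. 1 - of_nat p powr -(1 + z) :: complex)"
  define H where "H = (\<lambda>z. 1 / (zeta_reg z * E z))"
  define A where "A = (\<lambda>N. \<Sum>n=1..N. a n / of_nat n)"
  have E_nz: "E z \<noteq> 0" if "Re z \<ge> 0" for z
  proof -
    have "of_nat p powr -(1 + z) \<noteq> (1 :: complex)" if "p \<in> B" for p
    proof -
      have "real p > 1"
        using assms(2)[OF that] prime_gt_1_nat by auto
      then have "real p powr -(1 + Re z) < 1"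
        using \<open>Re z \<ge> 0\<close> by (subst powr_less_one) auto
      then have "norm (of_nat p powr -(1 + z) :: complex) < 1"
        by (simp add: norm_nat_powr)
      then show ?thesis
        by auto
    qed
    then show ?thesis
      using assms(1) by (auto simp: E_def)
  qed
  have "E holomorphic_on UNIV"
    unfolding E_def by (intro holomorphic_intros)
  then have E_diff: "E field_differentiable at z" for z
    by (auto simp: holomorphic_on_def)
  have H_diff: "H field_differentiable at z" if "Re z \<ge> 0" for z
    unfolding H_def using that E_nz[OF that] zeta_reg_nonzero[OF that]
    by (intro field_differentiable_divide field_differentiable_mult field_differentiable_const
        zeta_reg_differentiable E_diff) auto
  have eq: "(\<Sum>n. a n * of_nat n powr -(1 + z)) = z * H z" if "Re z > 0" for z
  proof -
    have "(\<Sum>n. a n * of_nat n powr -(1 + z)) * ((\<Sum>n. of_nat n powr -(1 + z)) * E z) = 1"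
      unfolding a_def E_def using dirichlet_series_moebius_away[OF assms, of "1 + z"] that by simp
    then have "(\<Sum>n. a n * of_nat n powr -(1 + z)) * (zeta_reg z * E z) = z"
      using zeta_reg_eq_zeta[OF that] by (simp add: mult_ac)
    moreover have "zeta_reg z * E z \<noteq> 0"
      using E_nz zeta_reg_nonzero that by simp
    ultimately show ?thesis
      by (simp add: H_def field_simps)
  qed
  have a_le: "norm (a n) \<le> 1" for n
    unfolding a_def by (rule norm_moebius_away_le_1)
  have A: "A \<longlonglongrightarrow> 0"
    unfolding A_def by (rule newman_tauberian[OF a_le H_diff eq])
  \<comment> \<open>Partial summation; the second sum is controlled by Cesaro's theorem.\<close>
  have "(\<Sum>n=1..N. a n) = of_nat (Suc N) * A N - (\<Sum>n=1..N. A n)" for N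
  proof (induction N)
    case (Suc N)
    have "of_nat (Suc N) * A (Suc N) = of_nat (Suc N) * A N + a (Suc N)"
      by (simp add: A_def distrib_left del: of_nat_Suc)
    then show ?case
      using Suc by (simp add: algebra_simps)
  qed (simp add: A_def)
  then have avg: "(\<Sum>n=1..N. a n) /\<^sub>R real N =
      (real (Suc N) / real N) *\<^sub>R A N - (\<Sum>n=1..N. A n) /\<^sub>R real N" for N
    by (simp add: scaleR_conv_of_real divide_inverse right_diff_distrib mult_ac)
  have "(\<lambda>N. real (Suc N) / real N) \<longlonglongrightarrow> 1"
    by real_asymp
  moreover have "(\<lambda>N. (\<Sum>n=1..N. A n) /\<^sub>R real N) \<longlonglongrightarrow> 0"
    using filterlim_compose[OF has_mean_value_tendsto_0[OF A, unfolded has_mean_value_def]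
        filterlim_real_sequentially] unfolding initial_segment_eq by simp
  ultimately have "(\<lambda>N. (real (Suc N) / real N) *\<^sub>R A N - (\<Sum>n=1..N. A n) /\<^sub>R real N)
      \<longlonglongrightarrow> 1 *\<^sub>R 0 - 0"
    by (intro tendsto_diff tendsto_scaleR A)
  then show ?thesis
    unfolding a_def [symmetric] by (intro has_mean_valueI_nat, unfold avg) simp
qed

section \<open>The density of the squarefree numbers\<close>

text \<open>Sieving by one further modulus \<open>q\<close> removes the numbers \<open>q n\<close> where \<open>n\<close> survived so far,
  because the other moduli are prime to \<open>q\<close>.\<close>

lemma has_mean_value_sieve:
  assumes "finite Q" "\<And>q. q \<in> Q \<Longrightarrow> q > 0"
    "\<And>q q'. q \<in> Q \<Longrightarrow> q' \<in> Q \<Longrightarrow> q \<noteq> q' \<Longrightarrow> coprime q q'"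
  shows "has_mean_value (\<lambda>n. of_bool (\<forall>q\<in>Q. \<not> q dvd n) :: real) (\<Prod>q\<in>Q. 1 - 1 / real q)"
  using assms
proof (induction Q rule: finite_induct)
  case empty
  then show ?case
    by (simp add: has_mean_value_1)
next
  case (insert q Q)
  define f where "f = (\<lambda>n. of_bool (\<forall>q\<in>Q. \<not> q dvd n) :: real)"
  have IH: "has_mean_value f (\<Prod>q\<in>Q. 1 - 1 / real q)"
    unfolding f_def using insert by auto
  have "q > 0"
    using insert.prems by auto
  have f_q: "f (q * n) = f n" for n
  proof -
    have "q' dvd q * n \<longleftrightarrow> q' dvd n" if "q' \<in> Q" for q'
    proof -
      have "coprime q' q"
        using insert.prems(2)[of q' q] insert.hyps that by auto
      then show ?thesis
        by (rule coprime_dvd_mult_right_iff)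
    qed
    then show ?thesis
      by (simp add: f_def)
  qed
  have "(\<lambda>n. of_bool (\<forall>q\<in>insert q Q. \<not> q dvd n) :: real) =
      (\<lambda>n. f n - (if q dvd n then f (n div q) else 0))"
  proof
    fix n
    show "of_bool (\<forall>q\<in>insert q Q. \<not> q dvd n) = f n - (if q dvd n then f (n div q) else 0)"
    proof (cases "q dvd n")
      case True
      then obtain k where "n = q * k" ..
      then show ?thesis
        using \<open>q > 0\<close> f_q[of k] by simp
    qed (simp add: f_def)
  qed
  moreover have "has_mean_value (\<lambda>n. f n - (if q dvd n then f (n div q) else 0))
      ((\<Prod>q\<in>Q. 1 - 1 / real q) - (\<Prod>q\<in>Q. 1 - 1 / real q) /\<^sub>R real q)"
    by (intro has_mean_value_diff has_mean_value_dilate IH \<open>q > 0\<close>)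
  ultimately show ?case
    using insert.hyps by (simp add: algebra_simps divide_inverse)
qed

lemma euler_product_zeta_2: "(\<lambda>N. \<Prod>p | prime p \<and> p \<le> N. 1 - 1 / (real p)\<^sup>2) \<longlonglongrightarrow> 6 / pi\<^sup>2"
proof -
  have powr: "of_nat n powr -2 = (of_real (1 / (real n)\<^sup>2) :: complex)" for n
    by (cases "n = 0") (simp_all add: powr_minus divide_inverse)
  have "(\<lambda>n. 1 / (real n)\<^sup>2) sums (pi\<^sup>2 / 6)"
    using inverse_squares_sums sums_Suc_iff[of "\<lambda>n. 1 / (real n)\<^sup>2" "pi\<^sup>2 / 6"]
    by (simp add: add.commute)
  then have zeta_2: "(\<Sum>n. of_nat n powr -2 :: complex) = of_real (pi\<^sup>2 / 6)"
    unfolding powr by (intro sums_unique[symmetric] sums_of_real)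
  have "(\<lambda>N. of_real ((\<Prod>p | prime p \<and> p \<le> N. 1 - 1 / (real p)\<^sup>2) * (pi\<^sup>2 / 6)) :: complex) \<longlonglongrightarrow> of_real 1"
    using euler_product_tendsto[of 2] unfolding zeta_2 unfolding powr by simp
  then have "(\<lambda>N. (\<Prod>p | prime p \<and> p \<le> N. 1 - 1 / (real p)\<^sup>2) * (pi\<^sup>2 / 6)) \<longlonglongrightarrow> 1"
    by (subst (asm) tendsto_of_real_iff)
  then have "(\<lambda>N. (\<Prod>p | prime p \<and> p \<le> N. 1 - 1 / (real p)\<^sup>2) * (pi\<^sup>2 / 6) * (6 / pi\<^sup>2)) \<longlonglongrightarrow> 1 * (6 / pi\<^sup>2)"
    by (intro tendsto_intros)
  then show ?thesis
    by simp
qed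

lemma card_multiples_le: "m > 0 \<Longrightarrow> real (card {n \<in> {1..X}. m dvd n}) \<le> real X / real m"
proof -
  assume m: "m > 0"
  have "{n \<in> {1..X}. m dvd n} \<subseteq> (*) m ` {1..X div m}"
  proof
    fix n assume n: "n \<in> {n \<in> {1..X}. m dvd n}"
    then obtain k where k: "n = m * k"
      by auto
    then have "k \<in> {1..X div m}"
      using n m by (auto simp: less_eq_div_iff_mult_less_eq mult.commute Suc_le_eq)
    then show "n \<in> (*) m ` {1..X div m}"
      using k by blast
  qed
  then have "card {n \<in> {1..X}. m dvd n} \<le> card ((*) m ` {1..X div m})"
    by (intro card_mono) auto
  also have "\<dots> \<le> X div m"
    using card_image_le[of "{1..X div m}" "(*) m"] by simp
  finally have "real (card {n \<in> {1..X}. m dvd n}) \<le> real (X div m)"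
    by simp
  also have "\<dots> \<le> real X / real m"
    by (rule of_nat_div_le_of_nat)
  finally show ?thesis .
qed

lemma card_large_square_divisor_le:
  assumes "N \<ge> 1"
  shows "real (card {n \<in> {1..X}. \<exists>d>N. d\<^sup>2 dvd n}) \<le> real X / real N"
proof -
  have "{n \<in> {1..X}. \<exists>d>N. d\<^sup>2 dvd n} \<subseteq> (\<Union>d\<in>{N<..X}. {n \<in> {1..X}. d\<^sup>2 dvd n})"
  proof
    fix n assume "n \<in> {n \<in> {1..X}. \<exists>d>N. d\<^sup>2 dvd n}"
    then obtain d where d: "n \<in> {1..X}" "d > N" "d\<^sup>2 dvd n"
      by auto
    then have "d \<le> d\<^sup>2" "d\<^sup>2 \<le> n"
      by (auto simp: power2_eq_square dvd_imp_le)
    then show "n \<in> (\<Union>d\<in>{N<..X}. {n \<in> {1..X}. d\<^sup>2 dvd n})"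
      using d by (intro UN_I[of d]) auto
  qed
  then have "card {n \<in> {1..X}. \<exists>d>N. d\<^sup>2 dvd n} \<le> card (\<Union>d\<in>{N<..X}. {n \<in> {1..X}. d\<^sup>2 dvd n})"
    by (intro card_mono) auto
  also have "\<dots> \<le> (\<Sum>d\<in>{N<..X}. card {n \<in> {1..X}. d\<^sup>2 dvd n})"
    by (intro card_UN_le) auto
  finally have "real (card {n \<in> {1..X}. \<exists>d>N. d\<^sup>2 dvd n}) \<le>
      real (\<Sum>d\<in>{N<..X}. card {n \<in> {1..X}. d\<^sup>2 dvd n})"
    by (rule of_nat_mono)
  also have "\<dots> \<le> (\<Sum>d\<in>{N<..X}. real X / real (d\<^sup>2))"
    unfolding of_nat_sum using assms by (intro sum_mono card_multiples_le) auto
  also have "\<dots> = real X * (\<Sum>d\<in>{N<..X}. 1 / (real d)\<^sup>2)"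
    by (simp add: sum_distrib_left)
  also have "\<dots> \<le> real X * (1 / real N)"
  proof (intro mult_left_mono)
    show "(\<Sum>d\<in>{N<..X}. 1 / (real d)\<^sup>2) \<le> 1 / real N"
    proof (cases "N \<le> X")
      case True
      have "(\<Sum>d\<in>{N<..X}. 1 / (real d)\<^sup>2) \<le> 1 / real N - 1 / real X"
        using True
      proof (induction X rule: dec_induct)
        case (step X)
        have "{N<..Suc X} = insert (Suc X) {N<..X}"
          using step.hyps by auto
        then have "(\<Sum>d\<in>{N<..Suc X}. 1 / (real d)\<^sup>2) = 1 / (real (Suc X))\<^sup>2 + (\<Sum>d\<in>{N<..X}. 1 / (real d)\<^sup>2)"
          by simp
        moreover have "1 / (real (Suc X))\<^sup>2 \<le> 1 / real X - 1 / real (Suc X)"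
        proof -
          have "1 / real X - 1 / real (Suc X) = 1 / (real X * real (Suc X))"
            using step.hyps assms by (simp add: field_simps)
          also have "\<dots> \<ge> 1 / (real (Suc X))\<^sup>2"
            using step.hyps assms by (intro divide_left_mono) (auto simp: power2_eq_square)
          finally show ?thesis .
        qed
        ultimately show ?case
          using step.IH by linarith
      qed simp
      then show ?thesis
        by (simp add: field_simps) (smt (verit) divide_nonneg_nonneg of_nat_0_le_iff)
    qed auto
  qed auto
  finally show ?thesis
    by simp
qed

text \<open>Squarefreeness away from \<open>B\<close> is the limit of conditions involving finitely many
  pairwise coprime moduli; the integers on which such a condition is wrong are divisible by
  the square of a prime beyond the sieving range and have small upper density.\<close>

theorem has_mean_value_squarefree_away:
  assumes "finite B" "\<And>p. p \<in> B \<Longrightarrow> prime p"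
  shows "has_mean_value (\<lambda>n. (real_of_int (moebius_away B n))\<^sup>2)
           (6 / pi\<^sup>2 * (\<Prod>p\<in>B. real p / (real p + 1)))"
proof -
  define P where "P = (\<lambda>N. {p. prime p \<and> p \<le> Suc N} - B)"
  define Q where "Q = (\<lambda>N. B \<union> (\<lambda>p. p\<^sup>2) ` P N)"
  define g where "g = (\<lambda>N n. of_bool (\<forall>q\<in>Q N. \<not> q dvd n) :: real)"
  define m where "m = (\<lambda>N. (\<Prod>p\<in>B. 1 - 1 / real p) * (\<Prod>p\<in>P N. 1 - 1 / (real p)\<^sup>2))"
  have finP: "finite (P N)" for N
    unfolding P_def by (rule finite_subset[of _ "{..Suc N}"]) auto
  have not_sq: "p \<noteq> p'\<^sup>2" if "prime p" "prime p'" for p p' :: nat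
    using that by (auto simp: prime_power_iff)
  show ?thesis
  proof (rule has_mean_value_approx)
    fix N
    have "has_mean_value (g N) (\<Prod>q\<in>Q N. 1 - 1 / real q)"
      unfolding g_def
    proof (rule has_mean_value_sieve)
      show "finite (Q N)"
        using assms(1) finP by (simp add: Q_def)
      have Q: "\<exists>p. prime p \<and> q = p ^ (if p \<in> B then 1 else 2)" if "q \<in> Q N" for q
        using that assms(2) unfolding Q_def P_def by (elim UnE imageE) auto
      show "q > 0" if "q \<in> Q N" for q
        using Q[OF that] prime_gt_0_nat by auto
      show "coprime q q'" if "q \<in> Q N" "q' \<in> Q N" "q \<noteq> q'" for q q'
      proof -
        obtain p where p: "prime p" "q = p ^ (if p \<in> B then 1 else 2)"
          using Q[OF \<open>q \<in> Q N\<close>] by blast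
        obtain p' where p': "prime p'" "q' = p' ^ (if p' \<in> B then 1 else 2)"
          using Q[OF \<open>q' \<in> Q N\<close>] by blast
        have "p \<noteq> p'"
          using p p' \<open>q \<noteq> q'\<close> by auto
        then have "coprime p p'"
          using p p' primes_coprime by blast
        then show ?thesis
          using p p' by simp
      qed
    qed
    also have "(\<Prod>q\<in>Q N. 1 - 1 / real q) = (\<Prod>p\<in>B. 1 - 1 / real p) * (\<Prod>q\<in>(\<lambda>p. p\<^sup>2) ` P N. 1 - 1 / real q)"
      unfolding Q_def using assms finP not_sq by (intro prod.union_disjoint) (auto simp: P_def)
    also have "(\<Prod>q\<in>(\<lambda>p. p\<^sup>2) ` P N. 1 - 1 / real q) = (\<Prod>p\<in>P N. 1 - 1 / (real p)\<^sup>2)"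
      by (subst prod.reindex) (auto simp: inj_on_def)
    finally show "has_mean_value (g N) (m N)"
      by (simp add: m_def)
  next
    fix N X
    have "norm (\<Sum>n=1..X. g N n - (real_of_int (moebius_away B n))\<^sup>2)
        \<le> (\<Sum>n=1..X. of_bool (\<exists>d>Suc N. d\<^sup>2 dvd n))"
    proof (intro sum_norm_le)
      fix n assume n: "n \<in> {1..X}"
      have *: "(real_of_int (moebius_away B n))\<^sup>2 = of_bool (squarefree n \<and> (\<forall>p\<in>B. \<not> p dvd n))"
        using moebius_mu_cases[of n] moebius_mu_eq_0_iff[of n] by (auto simp: moebius_away_def)
      have sqf: "squarefree n \<longleftrightarrow> (\<forall>p. prime p \<longrightarrow> \<not> p\<^sup>2 dvd n)"
        using n by (intro squarefree_factorial_semiring) auto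
      show "norm (g N n - (real_of_int (moebius_away B n))\<^sup>2) \<le> of_bool (\<exists>d>Suc N. d\<^sup>2 dvd n)"
      proof (cases "squarefree n \<or> (\<exists>p\<in>B. p dvd n)")
        case True
        then have "g N n = of_bool (squarefree n \<and> (\<forall>p\<in>B. \<not> p dvd n))"
          using sqf by (auto simp: g_def Q_def P_def)
        then show ?thesis
          unfolding * by simp
      next
        case False
        then obtain p where p: "prime p" "p\<^sup>2 dvd n"
          using sqf by auto
        then have "p dvd n"
          by (metis dvd_mult_left power2_eq_square)
        then have "p \<notin> B"
          using False by auto
        show ?thesis
        proof (cases "p \<le> Suc N")
          case True
          then have "p\<^sup>2 \<in> Q N"
            using p \<open>p \<notin> B\<close> by (auto simp: Q_def P_def)
          then have "g N n = 0"
            using p by (auto simp: g_def)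
          then show ?thesis
            unfolding * using False by simp
        next
          case False
          then have "\<exists>d>Suc N. d\<^sup>2 dvd n"
            using p by (intro exI[of _ p]) auto
          then show ?thesis
            unfolding * by (simp add: g_def)
        qed
      qed
    qed
    also have "\<dots> = real (card {n \<in> {1..X}. \<exists>d>Suc N. d\<^sup>2 dvd n})"
      by (simp add: sum.If_cases of_bool_def Int_def)
    also have "\<dots> \<le> 1 / real (Suc N) * real X"
      using card_large_square_divisor_le[of "Suc N" X] by simp
    finally show "norm (\<Sum>n=1..X. g N n - (real_of_int (moebius_away B n))\<^sup>2) \<le> 1 / real (Suc N) * real X" .
  next
    show "(\<lambda>N. 1 / real (Suc N)) \<longlonglongrightarrow> 0"
      by real_asymp
  next
    have nz: "1 - 1 / (real p)\<^sup>2 \<noteq> 0" if "p \<in> B" for p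
      using prime_gt_1_nat[OF assms(2)[OF that]] by (auto simp: power2_eq_1_iff)
    define E where "E = (\<Prod>p\<in>B. 1 - 1 / (real p)\<^sup>2)"
    have "E \<noteq> 0"
      using nz assms(1) by (simp add: E_def)
    have "(\<lambda>N. (\<Prod>p\<in>B. 1 - 1 / real p) * ((\<Prod>p | prime p \<and> p \<le> Suc N. 1 - 1 / (real p)\<^sup>2) / E))
        \<longlonglongrightarrow> (\<Prod>p\<in>B. 1 - 1 / real p) * (6 / pi\<^sup>2 / E)"
      by (intro tendsto_intros filterlim_compose[OF euler_product_zeta_2 filterlim_Suc] \<open>E \<noteq> 0\<close>)
    moreover have "\<forall>\<^sub>F N in sequentially. (\<Prod>p\<in>B. 1 - 1 / real p) *
        ((\<Prod>p | prime p \<and> p \<le> Suc N. 1 - 1 / (real p)\<^sup>2) / E) = m N"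
    proof (rule eventually_sequentiallyI)
      fix N assume N: "Max (insert 0 B) \<le> N"
      have "B \<subseteq> {p. prime p \<and> p \<le> Suc N}"
        using assms N by (auto simp: le_SucI)
      moreover have "finite {p :: nat. prime p \<and> p \<le> Suc N}"
        by (rule finite_subset[of _ "{..Suc N}"]) auto
      ultimately have "(\<Prod>p | prime p \<and> p \<le> Suc N. 1 - 1 / (real p)\<^sup>2) = (\<Prod>p\<in>P N. 1 - 1 / (real p)\<^sup>2) * E"
        unfolding P_def E_def by (rule prod.subset_diff)
      then show "(\<Prod>p\<in>B. 1 - 1 / real p) *
        ((\<Prod>p | prime p \<and> p \<le> Suc N. 1 - 1 / (real p)\<^sup>2) / E) = m N"
        using \<open>E \<noteq> 0\<close> by (simp add: m_def)
    qed
    ultimately have "m \<longlonglongrightarrow> (\<Prod>p\<in>B. 1 - 1 / real p) * (6 / pi\<^sup>2 / E)"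
      by (rule Lim_transform_eventually)
    also have "(\<Prod>p\<in>B. 1 - 1 / real p) * (6 / pi\<^sup>2 / E) =
        6 / pi\<^sup>2 * (\<Prod>p\<in>B. (1 - 1 / real p) / (1 - 1 / (real p)\<^sup>2))"
      by (simp add: E_def prod_dividef)
    also have "(\<Prod>p\<in>B. (1 - 1 / real p) / (1 - 1 / (real p)\<^sup>2)) = (\<Prod>p\<in>B. real p / (real p + 1))"
    proof (rule prod.cong)
      fix p assume "p \<in> B"
      then have p: "real p > 1"
        using prime_gt_1_nat[OF assms(2)] by simp
      have "1 - 1 / (real p)\<^sup>2 = (1 - 1 / real p) * ((real p + 1) / real p)"
        using p by (simp add: field_simps power2_eq_square)
      then show "(1 - 1 / real p) / (1 - 1 / (real p)\<^sup>2) = real p / (real p + 1)"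
        using p by simp
    qed simp
    finally show "m \<longlonglongrightarrow> 6 / pi\<^sup>2 * (\<Prod>p\<in>B. real p / (real p + 1))" .
  qed
qed

section \<open>Taylor coefficients as sums over partitions\<close>

text \<open>For \<open>e \<in> {-1, 0, 1}\<close> this is the coefficient of \<open>x\<^sup>m\<close> in \<open>(1 - x)\<^sup>e\<close>, in the form in which
  it is a polynomial in \<open>e\<close>.\<close>

definition euler_coeff :: "int \<Rightarrow> nat \<Rightarrow> int" where
  "euler_coeff e m = (if m = 0 then 1 else if m = 1 then -e else e * (e - 1) div 2)"

lemma euler_coeff_simps:
  "euler_coeff e 0 = 1" "euler_coeff e 1 = -e" "m \<ge> 2 \<Longrightarrow> euler_coeff e m = e * (e - 1) div 2"
  by (simp_all add: euler_coeff_def)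

lemma euler_coeff_0: "m > 0 \<Longrightarrow> euler_coeff 0 m = 0"
  by (simp add: euler_coeff_def)

definition euler_fps :: "int \<Rightarrow> nat \<Rightarrow> complex fps" where
  "euler_fps e d = Abs_fps (\<lambda>k. if d dvd k then of_int (euler_coeff e (k div d)) else 0)"

lemma has_fps_expansion_euler_fps:
  assumes "d > 0" "e \<in> {-1, 0, 1}"
  shows "(\<lambda>z. (1 - z ^ d) powi e) has_fps_expansion euler_fps e d"
proof -
  have base: "(\<lambda>z :: complex. 1 - z ^ d) has_fps_expansion (1 - fps_X ^ d)"
    by (intro fps_expansion_intros)
  consider "e = 0" | "e = 1" | "e = -1"
    using assms(2) by auto
  then show ?thesis
  proof cases
    case 1
    have "euler_fps 0 d = 1"
      using assms(1) by (intro fps_ext) (auto simp: euler_fps_def euler_coeff_def)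
    then show ?thesis
      using 1 by simp
  next
    case 2
    have "euler_fps 1 d = 1 - fps_X ^ d"
      using assms(1)
      by (intro fps_ext) (auto simp: euler_fps_def euler_coeff_def fps_X_power_nth elim!: dvdE)
    then show ?thesis
      using 2 base by simp
  next
    case 3
    have "(1 - fps_X ^ d) * euler_fps (-1) d = 1"
    proof (rule fps_ext)
      fix n
      have "fps_nth ((1 - fps_X ^ d) * euler_fps (-1) d) n =
          fps_nth (euler_fps (-1) d) n - fps_nth (fps_X ^ d * euler_fps (-1) d) n"
        by (simp add: left_diff_distrib)
      also have "\<dots> = of_bool (d dvd n) - (if n < d then 0 else of_bool (d dvd n - d))"
        unfolding fps_X_power_mult_nth by (simp add: euler_fps_def euler_coeff_def)
      also have "\<dots> = fps_nth 1 n"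
        using assms(1) by (auto simp: dvd_minus_self elim: dvdE)
      finally show "fps_nth ((1 - fps_X ^ d) * euler_fps (-1) d) n = fps_nth 1 n" .
    qed
    then have "euler_fps (-1) d = inverse (1 - fps_X ^ d)"
      by (metis fps_inverse_unique)
    moreover have "(\<lambda>z :: complex. inverse (1 - z ^ d)) has_fps_expansion inverse (1 - fps_X ^ d)"
      using assms(1) by (intro has_fps_expansion_inverse base) simp
    ultimately show ?thesis
      using 3 by (simp add: power_int_minus)
  qed
qed

text \<open>Choosing a term \<open>x\<^sup>d\<^sup>m\<close> from each factor amounts to choosing the multiplicity \<open>m\<close> of the
  part \<open>d\<close> in a partition.\<close>

lemma nth_prod_euler_fps:
  assumes "finite D" "0 \<notin> D"
  shows "fps_nth (\<Prod>d\<in>D. euler_fps (e d) d) k =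
         of_int (\<Sum>\<Lambda> | \<Lambda> \<in> int_partitions k \<and> set_mset \<Lambda> \<subseteq> D. \<Prod>d\<in>D. euler_coeff (e d) (count \<Lambda> d))"
  using assms
proof (induction D arbitrary: k rule: finite_induct)
  case empty
  have "{\<Lambda>. \<Lambda> \<in> int_partitions k \<and> set_mset \<Lambda> \<subseteq> {}} = (if k = 0 then {{#}} else {})"
    by (auto simp: int_partitions_def)
  then show ?case
    by simp
next
  case (insert d D)
  define Part where "Part = (\<lambda>k D. {\<Lambda>. \<Lambda> \<in> int_partitions k \<and> set_mset \<Lambda> \<subseteq> D})"
  define w where "w = (\<lambda>D \<Lambda>. \<Prod>x\<in>D. euler_coeff (e x) (count \<Lambda> x))"
  have d: "d > 0"
    using insert.prems by (intro Nat.gr0I) auto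
  have finPart: "finite (Part k D)" for k D
    unfolding Part_def by (rule finite_subset[OF _ finite_int_partitions[of k]]) auto
  define M where "M = {m. d * m \<le> k}"
  have finM: "finite M"
  proof (rule finite_subset)
    show "M \<subseteq> {..k}"
    proof
      fix m assume "m \<in> M"
      moreover have "m \<le> d * m"
        using d by simp
      ultimately show "m \<in> {..k}"
        unfolding M_def by (metis atMost_iff le_trans mem_Collect_eq)
    qed
  qed simp
  have "fps_nth (\<Prod>x\<in>insert d D. euler_fps (e x) x) k =
      (\<Sum>i=0..k. fps_nth (euler_fps (e d) d) i * fps_nth (\<Prod>x\<in>D. euler_fps (e x) x) (k - i))"
    using insert.hyps by (simp add: fps_mult_nth)
  also have "\<dots> = (\<Sum>i\<in>(*) d ` M. fps_nth (euler_fps (e d) d) i * fps_nth (\<Prod>x\<in>D. euler_fps (e x) x) (k - i))"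
    by (intro sum.mono_neutral_right) (auto simp: M_def euler_fps_def elim!: dvdE)
  also have "\<dots> = (\<Sum>m\<in>M. fps_nth (euler_fps (e d) d) (d * m) * fps_nth (\<Prod>x\<in>D. euler_fps (e x) x) (k - d * m))"
    using d by (subst sum.reindex) (auto simp: inj_on_def)
  also have "\<dots> = (\<Sum>m\<in>M. of_int (\<Sum>\<Lambda>\<in>Part (k - d * m) D. euler_coeff (e d) m * w D \<Lambda>))"
    using insert d by (intro sum.cong) (auto simp: euler_fps_def Part_def w_def sum_distrib_left)
  also have "\<dots> = of_int (\<Sum>m\<in>M. \<Sum>\<Lambda>\<in>Part (k - d * m) D. euler_coeff (e d) m * w D \<Lambda>)"
    by simp
  also have "(\<Sum>m\<in>M. \<Sum>\<Lambda>\<in>Part (k - d * m) D. euler_coeff (e d) m * w D \<Lambda>) =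
      (\<Sum>(m, \<Lambda>)\<in>Sigma M (\<lambda>m. Part (k - d * m) D). euler_coeff (e d) m * w D \<Lambda>)"
    using finM finPart by (intro sum.Sigma) auto
  also have "\<dots> = (\<Sum>\<Lambda>\<in>Part k (insert d D). w (insert d D) \<Lambda>)"
  proof (rule sum.reindex_bij_witness[of _ "\<lambda>\<Lambda>. (count \<Lambda> d, filter_mset (\<lambda>x. x \<noteq> d) \<Lambda>)"
        "\<lambda>(m, \<Lambda>). \<Lambda> + replicate_mset m d"])
    fix p assume "p \<in> Sigma M (\<lambda>m. Part (k - d * m) D)"
    then obtain m \<Lambda> where p: "p = (m, \<Lambda>)" "d * m \<le> k" "0 \<notin># \<Lambda>" "sum_mset \<Lambda> = k - d * m" "set_mset \<Lambda> \<subseteq> D"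
      by (auto simp: M_def Part_def int_partitions_def)
    have "d \<notin># \<Lambda>"
      using p insert.hyps by auto
    then have "filter_mset (\<lambda>x. x \<noteq> d) \<Lambda> = \<Lambda>"
      by (auto simp: filter_mset_eq_conv)
    with \<open>d \<notin># \<Lambda>\<close> show "(count (case p of (m, \<Lambda>) \<Rightarrow> \<Lambda> + replicate_mset m d) d,
        {#x \<in># case p of (m, \<Lambda>) \<Rightarrow> \<Lambda> + replicate_mset m d. x \<noteq> d#}) = p"
      by (simp add: p count_eq_zero_iff)
    show "(case p of (m, \<Lambda>) \<Rightarrow> \<Lambda> + replicate_mset m d) \<in> Part k (insert d D)"
      using p d by (auto simp: Part_def int_partitions_def sum_mset_replicate_mset mult.commute)
    have "w D (\<Lambda> + replicate_mset m d) = w D \<Lambda>"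
      unfolding w_def using insert.hyps by (intro prod.cong) auto
    then show "w (insert d D) (case p of (m, \<Lambda>) \<Rightarrow> \<Lambda> + replicate_mset m d) =
        (case p of (m, \<Lambda>) \<Rightarrow> euler_coeff (e d) m * w D \<Lambda>)"
      using insert.hyps \<open>d \<notin># \<Lambda>\<close> by (simp add: p w_def not_in_iff)
  next
    fix \<Lambda> assume \<Lambda>: "\<Lambda> \<in> Part k (insert d D)"
    have split: "filter_mset (\<lambda>x. x \<noteq> d) \<Lambda> + replicate_mset (count \<Lambda> d) d = \<Lambda>"
      by (rule multiset_eqI) auto
    then show "(case (count \<Lambda> d, filter_mset (\<lambda>x. x \<noteq> d) \<Lambda>) of (m, \<Lambda>) \<Rightarrow> \<Lambda> + replicate_mset m d) = \<Lambda>"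
      by simp
    have "k = sum_mset (filter_mset (\<lambda>x. x \<noteq> d) \<Lambda> + replicate_mset (count \<Lambda> d) d)"
      unfolding split using \<Lambda> by (simp add: Part_def int_partitions_def)
    also have "\<dots> = sum_mset (filter_mset (\<lambda>x. x \<noteq> d) \<Lambda>) + d * count \<Lambda> d"
      by (simp add: sum_mset_replicate_mset mult.commute)
    finally show "(count \<Lambda> d, filter_mset (\<lambda>x. x \<noteq> d) \<Lambda>) \<in> Sigma M (\<lambda>m. Part (k - d * m) D)"
      using \<Lambda> by (auto simp: M_def Part_def int_partitions_def)
  qed
  finally show ?case
    by (simp add: Part_def w_def)
qed

text \<open>The value \<open>0\<close> outside the divisors of \<open>n\<close> lets the sum over partitions range over all
  partitions of \<open>k\<close>, independently of \<open>n\<close>: a part that does not divide \<open>n\<close> makes its term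
  vanish.\<close>

definition cyclo_exponent :: "int \<Rightarrow> nat \<Rightarrow> nat \<Rightarrow> int" where
  "cyclo_exponent \<epsilon> n d = (if d dvd n then \<epsilon> * moebius_mu (n div d) else 0)"

definition partition_term :: "int \<Rightarrow> nat \<Rightarrow> nat multiset \<Rightarrow> int" where
  "partition_term \<epsilon> n \<Lambda> = (\<Prod>d\<in>set_mset \<Lambda>. euler_coeff (cyclo_exponent \<epsilon> n d) (count \<Lambda> d))"

theorem cyclo_a_eps_eq_partition_sum:
  assumes "\<epsilon> \<in> {-1, 1}" "n > 0"
  shows "cyclo_a_eps \<epsilon> n k = of_int (\<Sum>\<Lambda>\<in>int_partitions k. partition_term \<epsilon> n \<Lambda>)"
proof -
  define D where "D = {d. d dvd n}"
  have D: "finite D" "0 \<notin> D"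
    using assms(2) by (auto simp: D_def)
  have "(\<lambda>z. \<Prod>d | d dvd n. (1 - z ^ d) powi (\<epsilon> * moebius_mu (n div d))) has_fps_expansion
      (\<Prod>d\<in>D. euler_fps (\<epsilon> * moebius_mu (n div d)) d)"
    unfolding D_def
  proof (intro has_fps_expansion_prod has_fps_expansion_euler_fps)
    fix d assume "d \<in> {d. d dvd n}"
    then show "d > 0"
      using assms(2) by (auto intro: Nat.gr0I)
    show "\<epsilon> * moebius_mu (n div d) \<in> {-1, 0, 1}"
      using assms(1) moebius_mu_cases[of "n div d"] by auto
  qed
  then have "cyclo_a_eps \<epsilon> n k = fps_nth (\<Prod>d\<in>D. euler_fps (\<epsilon> * moebius_mu (n div d)) d) k"
    by (simp add: cyclo_a_eps_def taylor_coeff0_def fps_expansion_eqI)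
  also have "\<dots> = of_int (\<Sum>\<Lambda> | \<Lambda> \<in> int_partitions k \<and> set_mset \<Lambda> \<subseteq> D.
      \<Prod>d\<in>D. euler_coeff (\<epsilon> * moebius_mu (n div d)) (count \<Lambda> d))"
    by (rule nth_prod_euler_fps[OF D])
  also have "(\<Sum>\<Lambda> | \<Lambda> \<in> int_partitions k \<and> set_mset \<Lambda> \<subseteq> D.
      \<Prod>d\<in>D. euler_coeff (\<epsilon> * moebius_mu (n div d)) (count \<Lambda> d)) =
      (\<Sum>\<Lambda> | \<Lambda> \<in> int_partitions k \<and> set_mset \<Lambda> \<subseteq> D. partition_term \<epsilon> n \<Lambda>)"
  proof (rule sum.cong)
    fix \<Lambda> assume "\<Lambda> \<in> {\<Lambda>. \<Lambda> \<in> int_partitions k \<and> set_mset \<Lambda> \<subseteq> D}"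
    then have "set_mset \<Lambda> \<subseteq> D"
      by simp
    have "(\<Prod>d\<in>D. euler_coeff (\<epsilon> * moebius_mu (n div d)) (count \<Lambda> d)) =
        (\<Prod>d\<in>set_mset \<Lambda>. euler_coeff (\<epsilon> * moebius_mu (n div d)) (count \<Lambda> d))"
      using D \<open>set_mset \<Lambda> \<subseteq> D\<close>
      by (intro prod.mono_neutral_right) (auto simp: not_in_iff euler_coeff_simps)
    also have "\<dots> = partition_term \<epsilon> n \<Lambda>"
      unfolding partition_term_def using \<open>set_mset \<Lambda> \<subseteq> D\<close>
      by (intro prod.cong) (auto simp: cyclo_exponent_def D_def)
    finally show "(\<Prod>d\<in>D. euler_coeff (\<epsilon> * moebius_mu (n div d)) (count \<Lambda> d)) = partition_term \<epsilon> n \<Lambda>" .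
  qed simp
  also have "\<dots> = (\<Sum>\<Lambda>\<in>int_partitions k. partition_term \<epsilon> n \<Lambda>)"
  proof (rule sum.mono_neutral_left[OF finite_int_partitions], blast, rule ballI)
    fix \<Lambda> assume "\<Lambda> \<in> int_partitions k - {\<Lambda>. \<Lambda> \<in> int_partitions k \<and> set_mset \<Lambda> \<subseteq> D}"
    then obtain d where d: "d \<in># \<Lambda>" "\<not> d dvd n"
      by (auto simp: D_def)
    then have "euler_coeff (cyclo_exponent \<epsilon> n d) (count \<Lambda> d) = 0"
      by (simp add: cyclo_exponent_def euler_coeff_0)
    then show "partition_term \<epsilon> n \<Lambda> = 0"
      unfolding partition_term_def using d by (intro prod_zero) auto
  qed
  finally show ?thesis .
qed

section \<open>Cyclotomic polynomials\<close>

lemma power_minus_1_factorization: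
  assumes "n > 0"
  shows "z ^ n - 1 = (\<Prod>j=1..n. z - cis (2 * pi * real j / real n))"
proof -
  define \<omega> where "\<omega> = (\<lambda>j. cis (2 * pi * real j / real n))"
  define q where "q = (\<Prod>j\<in>{..<n}. [:- \<omega> j, 1:])"
  have bij: "bij_betw \<omega> {..<n} {z. z ^ n = 1}"
    unfolding \<omega>_def by (rule Complex.bij_betw_roots_unity[OF assms])
  have deg: "degree q = n"
    by (simp add: q_def degree_prod_eq_sum_degree)
  have lead: "lead_coeff q = 1"
    unfolding q_def lead_coeff_prod by simp
  have "monom 1 n - 1 = q"
  proof (rule poly_eqI_degree_lead_coeff[where n = n and A = "{z. z ^ n = 1}"])
    show "coeff (monom 1 n - 1) n = coeff q n"
      using deg lead assms by simp
    show "card {z :: complex. z ^ n = 1} \<ge> n"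
      using card_roots_unity_eq[OF assms] by simp
    show "degree (monom 1 n - 1 :: complex poly) \<le> n"
      by (intro degree_diff_le) (auto simp: degree_monom_le)
    show "degree q \<le> n"
      using deg by simp
    fix z :: complex assume z: "z \<in> {z. z ^ n = 1}"
    then obtain j where "j < n" "z = \<omega> j"
      using bij by (metis bij_betw_imp_surj_on imageE lessThan_iff)
    then have "poly q z = 0"
      by (auto simp: q_def poly_prod intro!: prod_zero)
    then show "poly (monom 1 n - 1) z = poly q z"
      using z by (simp add: poly_monom)
  qed
  then have "poly (monom 1 n - 1) z = poly q z"
    by simp
  then have "z ^ n - 1 = (\<Prod>j\<in>{..<n}. z - \<omega> j)"
    by (simp add: poly_monom q_def poly_prod)
  also have "\<dots> = (\<Prod>j=1..n. z - \<omega> j)"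
  proof -
    have "\<omega> n = \<omega> 0"
      using assms by (simp add: \<omega>_def)
    have "{..<n} = insert 0 {1..<n}" "{1..n} = insert n {1..<n}"
      using assms by auto
    then show ?thesis
      using \<open>\<omega> n = \<omega> 0\<close> by simp
  qed
  finally show ?thesis
    by (simp add: \<omega>_def)
qed

lemma prod_power_int_exponent:
  fixes x :: "'a :: field"
  assumes "finite A" "x \<noteq> 0"
  shows "(\<Prod>a\<in>A. x powi f a) = x powi (\<Sum>a\<in>A. f a)"
  using assms by (induction A rule: finite_induct) (simp_all add: power_int_add)

lemma power_int_prod:
  fixes g :: "'b \<Rightarrow> 'a :: field"
  shows "(\<Prod>a\<in>A. g a) powi m = (\<Prod>a\<in>A. g a powi m)"
  by (induction A rule: infinite_finite_induct) (simp_all add: power_int_mult_distrib)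

text \<open>In the product over all divisors, each \<open>n\<close>-th root of unity \<open>\<zeta>\<^sup>i\<close> occurs with exponent
  \<open>\<Sum> \<mu>(e)\<close> over the common divisors \<open>e\<close> of \<open>i\<close> and \<open>n\<close>, so only the primitive ones survive.
  For \<open>n > 1\<close> the signs of \<open>1 - z\<^sup>d = -(z\<^sup>d - 1)\<close> cancel as \<open>\<Sum> \<mu>(n/d) = 0\<close>.\<close>

lemma poly_cyclotomic_eq_divisor_prod:
  assumes "n > 1" "norm z < 1"
  shows "poly (cyclotomic_poly n) z = (\<Prod>d | d dvd n. (1 - z ^ d) powi moebius_mu (n div d))"
proof -
  define r where "r = (\<lambda>i. z - cis (2 * pi * real i / real n))"
  have n: "n > 0" "finite {d. d dvd n}"
    using assms(1) by auto
  have r_nz: "r i \<noteq> 0" for i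
    using assms(2) by (auto simp: r_def)
  have flip: "(\<Prod>d | d dvd n. f d (n div d)) = (\<Prod>e | e dvd n. f (n div e) e)" for f :: "nat \<Rightarrow> nat \<Rightarrow> complex"
    using n by (intro prod.reindex_bij_witness[of _ "\<lambda>d. n div d" "\<lambda>d. n div d"])
      (auto elim!: dvdE)
  have roots: "z ^ (n div e) - 1 = (\<Prod>i | i \<in> {1..n} \<and> e dvd i. r i)" if e: "e dvd n" for e
  proof -
    obtain d where d: "n = e * d"
      using e ..
    then have pos: "e > 0" "d > 0"
      using n by auto
    have "z ^ d - 1 = (\<Prod>j=1..d. z - cis (2 * pi * real j / real d))"
      by (rule power_minus_1_factorization[OF pos(2)])
    also have "\<dots> = (\<Prod>i | i \<in> {1..n} \<and> e dvd i. r i)"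
      using pos by (intro prod.reindex_bij_witness[of _ "\<lambda>i. i div e" "\<lambda>j. e * j"])
        (auto simp: d r_def mult.assoc elim!: dvdE)
    finally show ?thesis
      using pos by (simp add: d)
  qed
  have "(\<Prod>d | d dvd n. (1 - z ^ d) powi moebius_mu (n div d)) =
      (\<Prod>d | d dvd n. (-1) powi moebius_mu (n div d) * (z ^ d - 1) powi moebius_mu (n div d))"
    by (simp flip: power_int_mult_distrib)
  also have "\<dots> = (\<Prod>d | d dvd n. (-1) powi moebius_mu (n div d)) *
      (\<Prod>d | d dvd n. (z ^ d - 1) powi moebius_mu (n div d))"
    by (rule prod.distrib)
  also have "(\<Prod>d | d dvd n. (-1 :: complex) powi moebius_mu (n div d)) = (\<Prod>e | e dvd n. (-1) powi moebius_mu e)"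
    by (rule flip[of "\<lambda>d e. (-1) powi moebius_mu e"])
  also have "\<dots> = 1"
    using sum_moebius_mu_divisors[OF n(1)] assms(1) by (simp add: prod_power_int_exponent n)
  also have "(\<Prod>d | d dvd n. (z ^ d - 1) powi moebius_mu (n div d)) =
      (\<Prod>e | e dvd n. (z ^ (n div e) - 1) powi moebius_mu e)"
    by (rule flip[of "\<lambda>d e. (z ^ d - 1) powi moebius_mu e"])
  also have "\<dots> = (\<Prod>e\<in>{e. e dvd n}. \<Prod>i | i \<in> {1..n} \<and> e dvd i. r i powi moebius_mu e)"
    by (intro prod.cong) (simp_all add: roots power_int_prod)
  also have "\<dots> = (\<Prod>i=1..n. \<Prod>e | e \<in> {e. e dvd n} \<and> e dvd i. r i powi moebius_mu e)"
    using n by (intro prod.swap_restrict) auto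
  also have "\<dots> = (\<Prod>i=1..n. if coprime i n then r i else 1)"
  proof (rule prod.cong)
    fix i assume i: "i \<in> {1..n}"
    have "{e. e \<in> {e. e dvd n} \<and> e dvd i} = {e. e dvd gcd i n}"
      by auto
    moreover have "finite {e. e dvd gcd i n}"
      using n by simp
    ultimately have "(\<Prod>e | e \<in> {e. e dvd n} \<and> e dvd i. r i powi moebius_mu e) =
        r i powi (\<Sum>e | e dvd gcd i n. moebius_mu e)"
      by (simp only: prod_power_int_exponent r_nz not_False_eq_True)
    also have "(\<Sum>e | e dvd gcd i n. moebius_mu e) = (if gcd i n = 1 then 1 else 0)"
      by (rule sum_moebius_mu_divisors) (use n in simp)
    also have "r i powi (if gcd i n = 1 then 1 else 0) = (if coprime i n then r i else 1)"
      by (simp add: coprime_iff_gcd_eq_1)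
    finally show "(\<Prod>e | e \<in> {e. e dvd n} \<and> e dvd i. r i powi moebius_mu e) = (if coprime i n then r i else 1)" .
  qed simp
  also have "\<dots> = (\<Prod>i | i \<in> {1..n} \<and> coprime i n. r i)"
    by (subst prod.inter_filter) auto
  also have "\<dots> = poly (cyclotomic_poly n) z"
    by (simp add: cyclotomic_poly_def poly_prod r_def)
  finally show ?thesis
    by simp
qed

lemma taylor_coeff0_cong:
  assumes "\<And>z. norm z < 1 \<Longrightarrow> f z = g z"
  shows "taylor_coeff0 f k = taylor_coeff0 g k"
proof -
  have "\<forall>\<^sub>F z in nhds 0. z \<in> ball (0 :: complex) 1"
    by (rule eventually_nhds_in_open) auto
  then have "\<forall>\<^sub>F z in nhds 0. f z = g z"
    by eventually_elim (use assms in simp)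
  then have "fps_expansion f 0 = fps_expansion g 0"
    by (rule fps_expansion_cong)
  then show ?thesis
    by (simp add: taylor_coeff0_def)
qed

lemma cyclo_a_eq_cyclo_a_eps:
  assumes "n > 1"
  shows "cyclo_a n k = cyclo_a_eps 1 n k"
proof -
  have "poly (cyclotomic_poly n) has_fps_expansion fps_of_poly (cyclotomic_poly n)"
    by (simp add: has_fps_expansion_def)
  then have "cyclo_a n k = taylor_coeff0 (poly (cyclotomic_poly n)) k"
    by (simp add: cyclo_a_def taylor_coeff0_def fps_expansion_eqI)
  also have "\<dots> = cyclo_a_eps 1 n k"
    unfolding cyclo_a_eps_def
    by (rule taylor_coeff0_cong) (simp add: poly_cyclotomic_eq_divisor_prod[OF assms])
  finally show ?thesis .
qed

lemma cyclo_c_eq_cyclo_a_eps: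
  assumes "n > 1"
  shows "cyclo_c n k = cyclo_a_eps (-1) n k"
  unfolding cyclo_c_def cyclo_a_eps_def
  by (rule taylor_coeff0_cong)
     (simp add: poly_cyclotomic_eq_divisor_prod[OF assms] power_int_minus
       prod_inversef [unfolded o_def] inverse_eq_divide [symmetric])

section \<open>The mean value of one partition term\<close>

text \<open>For \<open>v = \<epsilon> \<mu>(m)\<close> this is the value of a partition term at \<open>n = L m\<close>, if \<open>m\<close> is squarefree
  and prime to \<open>L / G\<close>.\<close>

definition sign_term :: "nat multiset \<Rightarrow> int \<Rightarrow> int" where
  "sign_term \<Lambda> v = (\<Prod>d\<in>set_mset \<Lambda>. euler_coeff (v * moebius_mu (L_part \<Lambda> div d)) (count \<Lambda> d))"

locale positive_partition =
  fixes \<Lambda> :: "nat multiset"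
  assumes nonempty: "\<Lambda> \<noteq> {#}" and pos: "0 \<notin># \<Lambda>"
begin

lemma L_pos: "L_part \<Lambda> > 0"
  using pos by (auto simp: L_part_def Lcm_0_iff intro!: Nat.gr0I)

lemma part_dvd_L: "d \<in># \<Lambda> \<Longrightarrow> d dvd L_part \<Lambda>"
  by (simp add: L_part_def)

lemma G_dvd_part: "d \<in># \<Lambda> \<Longrightarrow> G_part \<Lambda> dvd d"
  by (simp add: G_part_def)

lemma G_dvd_L: "G_part \<Lambda> dvd L_part \<Lambda>"
proof -
  obtain d where "d \<in># \<Lambda>"
    using nonempty by blast
  then show ?thesis
    using part_dvd_L G_dvd_part dvd_trans by blast
qed

lemma G_pos: "G_part \<Lambda> > 0"
  using G_dvd_L L_pos by (auto intro: Nat.gr0I)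

lemma L_div_part_dvd: "d \<in># \<Lambda> \<Longrightarrow> L_part \<Lambda> div d dvd L_part \<Lambda> div G_part \<Lambda>"
proof -
  assume d: "d \<in># \<Lambda>"
  obtain a where a: "d = G_part \<Lambda> * a"
    using G_dvd_part[OF d] ..
  obtain b where b: "L_part \<Lambda> = d * b"
    using part_dvd_L[OF d] ..
  show ?thesis
    using L_pos G_pos a b by (auto simp: mult.assoc)
qed

text \<open>A square divisor of \<open>m L / G\<close> is already visible in \<open>m L / d\<close> for some part \<open>d\<close>, namely
  one for which \<open>d / G\<close> is prime to \<open>p\<close>.\<close>

lemma square_divisor_at_part:
  assumes "prime p" "p\<^sup>2 dvd m * (L_part \<Lambda> div G_part \<Lambda>)"
  obtains d where "d \<in># \<Lambda>" "p\<^sup>2 dvd m * (L_part \<Lambda> div d)"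
proof -
  have "\<exists>d\<in>#\<Lambda>. \<not> p * G_part \<Lambda> dvd d"
  proof (rule ccontr)
    assume "\<not> ?thesis"
    then have "p * G_part \<Lambda> dvd G_part \<Lambda>"
      unfolding G_part_def by (intro Gcd_greatest) auto
    then have "p * G_part \<Lambda> \<le> 1 * G_part \<Lambda>"
      using G_pos by (auto dest: dvd_imp_le)
    then show False
      using G_pos prime_gt_1_nat[OF assms(1)] by simp
  qed
  then obtain d where d: "d \<in># \<Lambda>" "\<not> p * G_part \<Lambda> dvd d"
    by auto
  obtain a where a: "d = G_part \<Lambda> * a"
    using G_dvd_part[OF d(1)] ..
  obtain b where b: "L_part \<Lambda> = d * b"
    using part_dvd_L[OF d(1)] ..
  have "\<not> p dvd a"
    using d(2) by (auto simp: a mult.commute)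
  then have "coprime (p\<^sup>2) a"
    using assms(1) by (simp add: prime_imp_coprime)
  moreover have "L_part \<Lambda> div G_part \<Lambda> = a * b" "L_part \<Lambda> div d = b"
    using L_pos G_pos a b by auto
  ultimately have "p\<^sup>2 dvd m * (L_part \<Lambda> div d)"
    using assms(2) by (simp add: mult.left_commute[of m a] coprime_dvd_mult_right_iff)
  with d(1) show ?thesis
    by (rule that)
qed

lemma partition_term_eq_0_if_not_dvd:
  assumes "\<not> L_part \<Lambda> dvd n"
  shows "partition_term \<epsilon> n \<Lambda> = 0"
proof -
  obtain d where d: "d \<in># \<Lambda>" "\<not> d dvd n"
    using assms Lcm_least[of "set_mset \<Lambda>" n] by (auto simp: L_part_def)
  then have "euler_coeff (cyclo_exponent \<epsilon> n d) (count \<Lambda> d) = 0"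
    by (simp add: cyclo_exponent_def euler_coeff_0)
  then show ?thesis
    unfolding partition_term_def using d by (intro prod_zero) auto
qed

lemma cyclo_exponent_multiple:
  assumes "d \<in># \<Lambda>"
  shows "cyclo_exponent \<epsilon> (L_part \<Lambda> * m) d = \<epsilon> * moebius_mu (m * (L_part \<Lambda> div d))"
  using part_dvd_L[OF assms] by (simp add: cyclo_exponent_def div_mult_swap mult.commute)

lemma partition_term_eq_0_if_not_squarefree:
  assumes "\<not> squarefree (m * (L_part \<Lambda> div G_part \<Lambda>))" "m > 0"
  shows "partition_term \<epsilon> (L_part \<Lambda> * m) \<Lambda> = 0"
proof -
  have "m * (L_part \<Lambda> div G_part \<Lambda>) \<noteq> 0"
    using assms(2) L_pos G_pos G_dvd_L by (auto elim!: dvdE)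
  then obtain p where p: "prime p" "p\<^sup>2 dvd m * (L_part \<Lambda> div G_part \<Lambda>)"
    using assms(1) by (auto simp: squarefree_factorial_semiring)
  obtain d where d: "d \<in># \<Lambda>" "p\<^sup>2 dvd m * (L_part \<Lambda> div d)"
    using square_divisor_at_part[OF p] .
  have "\<not> squarefree (m * (L_part \<Lambda> div d))"
    using d(2) p(1) by (auto dest!: squarefreeD)
  then have "euler_coeff (cyclo_exponent \<epsilon> (L_part \<Lambda> * m) d) (count \<Lambda> d) = 0"
    using d by (simp add: cyclo_exponent_multiple moebius_mu_eq_0_iff[THEN iffD2] euler_coeff_0)
  then show ?thesis
    unfolding partition_term_def using d by (intro prod_zero) auto
qed

text \<open>Since \<open>\<mu>(m L/d) = \<mu>(m) \<mu>(L/d)\<close> for the relevant \<open>m\<close>, the term depends on \<open>m\<close> only through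
  \<open>\<mu>(m)\<close>; interpolating between the two signs makes it linear in \<open>\<mu>(m)\<^sup>2\<close> and \<open>\<mu>(m)\<close>.\<close>

lemma partition_term_multiple:
  assumes \<epsilon>: "\<epsilon> \<in> {-1, 1}" and sqf: "squarefree (L_part \<Lambda> div G_part \<Lambda>)" and m: "m > 0"
  defines "a \<equiv> moebius_away (prime_factors (L_part \<Lambda> div G_part \<Lambda>)) m"
  shows "2 * partition_term \<epsilon> (L_part \<Lambda> * m) \<Lambda> =
    a\<^sup>2 * (sign_term \<Lambda> 1 + sign_term \<Lambda> (-1)) + \<epsilon> * a * (sign_term \<Lambda> 1 - sign_term \<Lambda> (-1))"
proof (cases "squarefree m \<and> coprime m (L_part \<Lambda> div G_part \<Lambda>)")
  case True
  have "\<not> (\<exists>p\<in>prime_factors (L_part \<Lambda> div G_part \<Lambda>). p dvd m)"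
  proof (safe)
    fix p assume p: "p \<in> prime_factors (L_part \<Lambda> div G_part \<Lambda>)" "p dvd m"
    then have "prime p" "p dvd L_part \<Lambda> div G_part \<Lambda>"
      by (auto simp: in_prime_factors_iff)
    moreover have "is_unit p"
      using True p(2) \<open>p dvd L_part \<Lambda> div G_part \<Lambda>\<close> by (meson coprime_common_divisor)
    ultimately show False
      by simp
  qed
  then have a: "a = moebius_mu m" "a \<in> {-1, 1}"
    using True moebius_mu_cases[of m] moebius_mu_eq_0_iff[of m]
    by (auto simp: a_def moebius_away_def)
  have "partition_term \<epsilon> (L_part \<Lambda> * m) \<Lambda> = sign_term \<Lambda> (\<epsilon> * a)"
    unfolding partition_term_def sign_term_def
  proof (rule prod.cong)
    fix d assume d: "d \<in># \<Lambda>"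
    have "coprime m (L_part \<Lambda> div d)"
      using coprime_divisors[OF dvd_refl L_div_part_dvd[OF d]] True by blast
    then show "euler_coeff (cyclo_exponent \<epsilon> (L_part \<Lambda> * m) d) (count \<Lambda> d) =
        euler_coeff (\<epsilon> * a * moebius_mu (L_part \<Lambda> div d)) (count \<Lambda> d)"
      using d by (simp add: cyclo_exponent_multiple moebius_mu_mult a(1) mult.assoc)
  qed simp
  then show ?thesis
    using a(2) \<epsilon> by auto
next
  case False
  have "\<not> squarefree (m * (L_part \<Lambda> div G_part \<Lambda>))"
  proof (cases "squarefree m")
    case True
    then obtain p where p: "prime p" "p dvd m" "p dvd L_part \<Lambda> div G_part \<Lambda>"
      using False by (meson coprime_iff_gcd_eq_1 gcd_dvd1 gcd_dvd2 prime_factor_nat dvd_trans)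
    then have "p\<^sup>2 dvd m * (L_part \<Lambda> div G_part \<Lambda>)"
      by (simp add: power2_eq_square mult_dvd_mono)
    then show ?thesis
      using p(1) by (auto dest!: squarefreeD)
  next
    case False
    then show ?thesis
      using squarefree_multD by blast
  qed
  then have "partition_term \<epsilon> (L_part \<Lambda> * m) \<Lambda> = 0"
    using m by (rule partition_term_eq_0_if_not_squarefree)
  moreover have "a = 0"
  proof (cases "squarefree m")
    case True
    then obtain p where p: "prime p" "p dvd m" "p dvd L_part \<Lambda> div G_part \<Lambda>"
      using False by (meson coprime_iff_gcd_eq_1 gcd_dvd1 gcd_dvd2 prime_factor_nat dvd_trans)
    have "L_part \<Lambda> div G_part \<Lambda> \<noteq> 0"
      using sqf by (metis not_squarefree_0)
    then show ?thesis
      using p by (auto simp: a_def moebius_away_def prime_factors_dvd)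
  qed (simp add: a_def moebius_away_def moebius_mu_eq_0_iff)
  ultimately show ?thesis
    by simp
qed

end

text \<open>Multiplicities weakly decrease along a listing, so the largest index of a repeated part
  separates the repeated parts from the simple ones, whatever the order among ties.\<close>

lemma t_index_properties:
  assumes "parts_listing \<Lambda> ks" "\<Lambda> \<noteq> {#}"
  shows "t_index \<Lambda> ks \<le> length ks"
    and "j \<in> {1..length ks} \<Longrightarrow> count \<Lambda> (part ks j) \<ge> 2 \<longleftrightarrow> j \<le> t_index \<Lambda> ks"
    and "length ks \<ge> 1"
proof -
  define T where "T = {j \<in> {1..length ks}. count \<Lambda> (part ks j) \<ge> 2}"
  have mono: "count \<Lambda> (part ks j) \<le> count \<Lambda> (part ks i)" if "1 \<le> i" "i \<le> j" "j \<le> length ks" for i j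
  proof (cases "i = j")
    case False
    have "sorted_wrt (\<lambda>a b. count \<Lambda> a \<ge> count \<Lambda> b) ks"
      using assms(1) by (simp add: parts_listing_def)
    then show ?thesis
      unfolding part_def by (rule sorted_wrt_nth_less) (use that False in auto)
  qed simp
  have "ks \<noteq> []"
    using assms by (auto simp: parts_listing_def)
  then show len: "length ks \<ge> 1"
    by (simp add: Suc_le_eq)
  have finT: "finite T"
    by (simp add: T_def)
  show "t_index \<Lambda> ks \<le> length ks"
  proof (cases "count \<Lambda> (part ks 1) \<ge> 2")
    case True
    then have "1 \<in> T"
      using len by (simp add: T_def)
    then have "Max T \<in> T"
      using finT by (intro Max_in) auto
    then show ?thesis
      using True by (simp add: t_index_def T_def [symmetric]) (simp add: T_def)
  qed (simp add: t_index_def)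
  show "count \<Lambda> (part ks j) \<ge> 2 \<longleftrightarrow> j \<le> t_index \<Lambda> ks" if j: "j \<in> {1..length ks}"
  proof (cases "count \<Lambda> (part ks 1) \<ge> 2")
    case True
    then have t: "t_index \<Lambda> ks = Max T"
      by (simp add: t_index_def T_def)
    have "1 \<in> T"
      using True len by (simp add: T_def)
    then have Max: "Max T \<in> T"
      using finT by (intro Max_in) auto
    show ?thesis
    proof
      assume "count \<Lambda> (part ks j) \<ge> 2"
      then have "j \<in> T"
        using j by (simp add: T_def)
      then show "j \<le> t_index \<Lambda> ks"
        unfolding t using finT by (intro Max_ge)
    next
      assume "j \<le> t_index \<Lambda> ks"
      then show "count \<Lambda> (part ks j) \<ge> 2"
        using mono[of j "Max T"] Max j unfolding t by (auto simp: T_def)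
    qed
  next
    case False
    then show ?thesis
      using mono[of 1 j] j by (auto simp: t_index_def)
  qed
qed

text \<open>A repeated part contributes \<open>1\<close> or \<open>0\<close> according to whether its exponent is \<open>-1\<close>, a simple
  part contributes minus its exponent. If there are repeated parts, at most one sign \<open>v\<close> gives
  a non-zero term; otherwise the two signs reinforce or cancel according to the parity of \<open>s\<close>.\<close>

lemma (in positive_partition) sign_term_average:
  assumes listing: "parts_listing \<Lambda> ks"
    and sqf: "squarefree (L_part \<Lambda> div G_part \<Lambda>)"
  shows "real_of_int (sign_term \<Lambda> 1 + sign_term \<Lambda> (-1)) = 2 * eps2 \<Lambda> ks"
proof -
  define s where "s = length ks"
  define t where "t = t_index \<Lambda> ks"
  define \<mu> where "\<mu> = (\<lambda>j. moebius_mu (L_part \<Lambda> div part ks j))"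
  define W where "W = (\<Prod>j=t+1..s. \<mu> j)"
  note t_props = t_index_properties[OF listing nonempty, folded t_def s_def]
  have mem: "part ks j \<in># \<Lambda>" if "j \<in> {1..s}" for j
  proof -
    have "part ks j \<in> set ks"
      using that by (auto simp: part_def s_def)
    then show ?thesis
      using listing by (simp add: parts_listing_def)
  qed
  have \<mu>: "\<mu> j \<in> {-1, 1}" if "j \<in> {1..s}" for j
  proof -
    have "squarefree (L_part \<Lambda> div part ks j)"
      using L_div_part_dvd[OF mem[OF that]] sqf by (rule squarefree_mono)
    then show ?thesis
      using moebius_mu_cases moebius_mu_eq_0_iff unfolding \<mu>_def by blast
  qed
  have "bij_betw (\<lambda>j. part ks j) {1..s} (set_mset \<Lambda>)"
  proof -
    have "bij_betw (\<lambda>i. ks ! i) {..<s} (set ks)"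
      using listing by (intro bij_betw_nth) (auto simp: parts_listing_def s_def)
    moreover have "bij_betw (\<lambda>j. j - 1) {1..s} {..<s}"
      by (rule bij_betw_byWitness[of _ Suc]) auto
    ultimately have "bij_betw ((\<lambda>i. ks ! i) \<circ> (\<lambda>j. j - 1)) {1..s} (set ks)"
      using bij_betw_trans by blast
    then show ?thesis
      using listing by (simp add: o_def part_def [abs_def] parts_listing_def)
  qed
  then have "sign_term \<Lambda> v = (\<Prod>j=1..s. euler_coeff (v * \<mu> j) (count \<Lambda> (part ks j)))" for v
    unfolding sign_term_def \<mu>_def by (rule prod.reindex_bij_betw[symmetric])
  moreover have "{1..s} = {1..t} \<union> {t+1..s}"
    using t_props(1) by auto
  ultimately have split: "sign_term \<Lambda> v =
      (\<Prod>j=1..t. euler_coeff (v * \<mu> j) (count \<Lambda> (part ks j))) *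
      (\<Prod>j=t+1..s. euler_coeff (v * \<mu> j) (count \<Lambda> (part ks j)))" for v
    by (simp add: prod.union_disjoint)
  have eval: "sign_term \<Lambda> v = of_bool (\<forall>j\<in>{1..t}. v * \<mu> j = -1) * (-v) ^ (s - t) * W"
    if v: "v \<in> {-1, 1}" for v
  proof -
    have "(\<Prod>j=1..t. euler_coeff (v * \<mu> j) (count \<Lambda> (part ks j))) = (\<Prod>j=1..t. of_bool (v * \<mu> j = -1))"
    proof (rule prod.cong)
      fix j assume "j \<in> {1..t}"
      then have j: "j \<in> {1..s}" "count \<Lambda> (part ks j) \<ge> 2"
        using t_props(1) t_props(2)[of j] by auto
      show "euler_coeff (v * \<mu> j) (count \<Lambda> (part ks j)) = of_bool (v * \<mu> j = -1)"
        using v \<mu>[OF j(1)] by (auto simp: euler_coeff_simps(3)[OF j(2)])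
    qed simp
    also have "\<dots> = of_bool (\<forall>j\<in>{1..t}. v * \<mu> j = -1)"
      by (auto simp: prod_zero_iff)
    moreover have "(\<Prod>j=t+1..s. euler_coeff (v * \<mu> j) (count \<Lambda> (part ks j))) = (\<Prod>j=t+1..s. -v * \<mu> j)"
    proof (rule prod.cong)
      fix j assume "j \<in> {t+1..s}"
      then have j: "j \<in> {1..s}" "\<not> count \<Lambda> (part ks j) \<ge> 2"
        using t_props(2)[of j] by auto
      then have "count \<Lambda> (part ks j) = 1"
        using mem[OF j(1)] by (simp add: count_greater_zero_iff [symmetric] del: count_greater_zero_iff)
      then show "euler_coeff (v * \<mu> j) (count \<Lambda> (part ks j)) = -v * \<mu> j"
        by (simp add: euler_coeff_def)
    qed simp
    moreover have "(\<Prod>j=t+1..s. -v * \<mu> j) = (-v) ^ (s - t) * W"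
      unfolding prod.distrib W_def by simp
    ultimately show ?thesis
      by (simp add: split)
  qed
  have eps2: "eps2 \<Lambda> ks = eps1 \<Lambda> ks * real_of_int W"
    by (simp add: eps2_def W_def t_def s_def \<mu>_def)
  have \<mu>Q: "moebius_mu (L_part \<Lambda> div G_part \<Lambda>) \<noteq> 0"
    using sqf by (simp add: moebius_mu_eq_0_iff)
  have count1: "count \<Lambda> (part ks 1) \<ge> 2 \<longleftrightarrow> t \<ge> 1"
    using t_props(2)[of 1] t_props(3) by simp
  show ?thesis
  proof (cases "t \<ge> 1")
    case False
    then have "t = 0" "\<not> count \<Lambda> (part ks 1) \<ge> 2"
      using count1 by auto
    have "part ks 1 \<in># \<Lambda>"
      using mem[of 1] t_props(3) by simp
    then have "count \<Lambda> (part ks 1) > 0"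
      by simp
    then have "count \<Lambda> (part ks 1) = 1"
      using \<open>\<not> count \<Lambda> (part ks 1) \<ge> 2\<close> by linarith
    then have "eps1 \<Lambda> ks = of_bool (even s)"
      using \<mu>Q unfolding eps1_def Let_def s_def by simp
    then show ?thesis
      using \<open>t = 0\<close> by (simp add: eval eps2)
  next
    case True
    define u where "u = \<mu> 1"
    define E where "E \<longleftrightarrow> (\<forall>j\<in>{1..t}. \<mu> j = u)"
    have u: "u \<in> {-1, 1}"
      using \<mu>[of 1] t_props(3) by (simp add: u_def)
    have "count \<Lambda> (part ks 1) \<ge> 2"
      using True count1 by simp
    then have "(count \<Lambda> (part ks 1) = 1) = False" "(count \<Lambda> (part ks 1) \<ge> 2) = True"
      by simp_all
    then have eps1: "eps1 \<Lambda> ks = (if E then real_of_int u ^ (s - t) / 2 else 0)"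
      unfolding eps1_def Let_def s_def t_def \<mu>_def u_def E_def
      using \<mu>Q by (simp only: simp_thms if_False not_False_eq_True)
    have "u * \<mu> 1 \<noteq> -1"
      using u unfolding u_def [symmetric] by auto
    then have "\<not> (\<forall>j\<in>{1..t}. u * \<mu> j = -1)"
      using True by (meson atLeastAtMost_iff order_refl)
    then have "sign_term \<Lambda> u = 0"
      using eval[OF u] by simp
    moreover have "sign_term \<Lambda> (-u) = of_bool E * u ^ (s - t) * W"
    proof -
      have "-u * \<mu> j = -1 \<longleftrightarrow> \<mu> j = u" for j
        using u by auto
      moreover have "-u \<in> {-1, 1}"
        using u by auto
      ultimately show ?thesis
        using eval[of "-u"] by (simp add: E_def)
    qed
    moreover have "sign_term \<Lambda> 1 + sign_term \<Lambda> (-1) = sign_term \<Lambda> u + sign_term \<Lambda> (-u)"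
      using u by auto
    ultimately have "sign_term \<Lambda> 1 + sign_term \<Lambda> (-1) = of_bool E * u ^ (s - t) * W"
      by simp
    then show ?thesis
      by (simp add: eps2 eps1)
  qed
qed

lemma prod_prime_factors_squarefree:
  assumes "squarefree (n :: nat)"
  shows "(\<Prod>p\<in>prime_factors n. p) = n"
proof -
  have n: "n \<noteq> 0"
    using assms by (metis not_squarefree_0)
  have "(\<Prod>p\<in>prime_factors n. p) = (\<Prod>p\<in>prime_factors n. p ^ multiplicity p n)"
    using assms n by (intro prod.cong) (auto simp: squarefree_factorial_semiring')
  also have "\<dots> = n"
    using prod_prime_factors[OF n] by simp
  finally show ?thesis .
qed

theorem (in positive_partition) has_mean_value_partition_term:
  assumes \<epsilon>: "\<epsilon> \<in> {-1, 1}" and listing: "parts_listing \<Lambda> ks"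
  shows "has_mean_value (\<lambda>n. of_int (partition_term \<epsilon> n \<Lambda>) :: complex)
     (of_real (6 / pi\<^sup>2 * (eps2 \<Lambda> ks / (real (G_part \<Lambda>) *
        (\<Prod>p\<in>prime_factors (L_part \<Lambda> div G_part \<Lambda>). real p + 1)))))"
proof -
  define Q where "Q = L_part \<Lambda> div G_part \<Lambda>"
  define B where "B = prime_factors Q"
  show ?thesis
  proof (cases "squarefree Q")
    case False
    have "partition_term \<epsilon> n \<Lambda> = 0" if "n \<ge> 1" for n
    proof (cases "L_part \<Lambda> dvd n")
      case True
      then obtain m where m: "n = L_part \<Lambda> * m" ..
      then have "m > 0"
        using that by (auto intro: Nat.gr0I)
      moreover have "\<not> squarefree (m * Q)"
        using False squarefree_multD by blast
      ultimately show ?thesis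
        unfolding m by (intro partition_term_eq_0_if_not_squarefree) (simp_all add: Q_def)
    qed (rule partition_term_eq_0_if_not_dvd)
    then have "has_mean_value (\<lambda>n. of_int (partition_term \<epsilon> n \<Lambda>) :: complex) 0"
      by (intro has_mean_value_cong[OF has_mean_value_0, of 1]) simp
    moreover have "moebius_mu Q = 0"
      using False by (simp add: moebius_mu_eq_0_iff)
    then have "eps2 \<Lambda> ks = 0"
      by (simp add: eps2_def eps1_def Let_def Q_def)
    ultimately show ?thesis
      by simp
  next
    case True
    define c where "c = of_int (\<epsilon> * (sign_term \<Lambda> 1 - sign_term \<Lambda> (-1))) / (2 :: complex)"
    define D where "D = 6 / pi\<^sup>2 * (\<Prod>p\<in>B. real p / (real p + 1))"
    define f where "f = (\<lambda>m. of_real (eps2 \<Lambda> ks) * of_real ((real_of_int (moebius_away B m))\<^sup>2)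
      + c * of_int (moebius_away B m) :: complex)"
    have B: "finite B" "\<And>p. p \<in> B \<Longrightarrow> prime p"
      by (auto simp: B_def)
    have "has_mean_value f (of_real (eps2 \<Lambda> ks) * of_real D + c * 0)"
      unfolding f_def D_def
      by (intro has_mean_value_add has_mean_value_cmult has_mean_value_of_real
          has_mean_value_squarefree_away has_mean_value_moebius_away B)
    then have "has_mean_value (\<lambda>n. if L_part \<Lambda> dvd n then f (n div L_part \<Lambda>) else 0)
        ((of_real (eps2 \<Lambda> ks) * of_real D + c * 0) /\<^sub>R real (L_part \<Lambda>))"
      using L_pos by (rule has_mean_value_dilate)
    then have "has_mean_value (\<lambda>n. of_int (partition_term \<epsilon> n \<Lambda>) :: complex)
        ((of_real (eps2 \<Lambda> ks) * of_real D + c * 0) /\<^sub>R real (L_part \<Lambda>))"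
    proof (rule has_mean_value_cong[where K = 1])
      fix n :: nat assume n: "n \<ge> 1"
      have f_eq: "of_int (partition_term \<epsilon> (L_part \<Lambda> * m) \<Lambda>) = f m" if "m > 0" for m
      proof -
        have "of_int (2 * partition_term \<epsilon> (L_part \<Lambda> * m) \<Lambda>) =
          (of_int ((moebius_away B m)\<^sup>2) * of_real (real_of_int (sign_term \<Lambda> 1 + sign_term \<Lambda> (-1)))
            + of_int (\<epsilon> * moebius_away B m * (sign_term \<Lambda> 1 - sign_term \<Lambda> (-1))) :: complex)"
          using partition_term_multiple[OF \<epsilon> True[unfolded Q_def] that] by (simp add: B_def Q_def)
        also have "\<dots> = 2 * f m"
          unfolding sign_term_average[OF listing True[unfolded Q_def]] f_def c_def by simp
        finally show ?thesis
          by simp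
      qed
      show "(if L_part \<Lambda> dvd n then f (n div L_part \<Lambda>) else 0) = of_int (partition_term \<epsilon> n \<Lambda>)"
      proof (cases "L_part \<Lambda> dvd n")
        case True
        then obtain m where m: "n = L_part \<Lambda> * m" ..
        then have "m > 0"
          using n by (auto intro: Nat.gr0I)
        then show ?thesis
          using f_eq[of m] L_pos by (simp add: m)
      qed (simp add: partition_term_eq_0_if_not_dvd)
    qed
    moreover have "eps2 \<Lambda> ks * D / real (L_part \<Lambda>) =
        6 / pi\<^sup>2 * (eps2 \<Lambda> ks / (real (G_part \<Lambda>) * (\<Prod>p\<in>B. real p + 1)))"
    proof -
      have "(\<Prod>p\<in>B. real p) = real Q"
        using prod_prime_factors_squarefree[OF True] by (simp add: B_def flip: of_nat_prod)
      then have D_eq: "D = 6 / pi\<^sup>2 * (real Q / (\<Prod>p\<in>B. real p + 1))"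
        by (simp add: D_def prod_dividef)
      have L_eq: "L_part \<Lambda> = Q * G_part \<Lambda>"
        using G_dvd_L by (simp add: Q_def)
      then have "real Q \<noteq> 0"
        using L_pos by (intro notI) simp
      then show ?thesis
        unfolding D_eq L_eq of_nat_mult by (simp add: mult.commute)
    qed
    moreover have "(of_real (eps2 \<Lambda> ks) * of_real D + c * 0) /\<^sub>R real (L_part \<Lambda>) =
        of_real (eps2 \<Lambda> ks * D / real (L_part \<Lambda>))"
      by (simp add: scaleR_conv_of_real divide_inverse mult_ac)
    ultimately show ?thesis
      unfolding B_def Q_def by (simp only:)
  qed
qed

section \<open>The mean values of the coefficients\<close>

theorem has_mean_value_cyclo_a_eps:
  fixes \<epsilon> :: int and k :: nat and listing :: "nat multiset \<Rightarrow> nat list"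
  assumes "\<epsilon> \<in> {-1, 1}"
    and "k \<ge> 1"
    and "\<And>\<Lambda>. \<Lambda> \<in> int_partitions k \<Longrightarrow> parts_listing \<Lambda> (listing \<Lambda>)"
  shows "has_mean_value (\<lambda>n. cyclo_a_eps \<epsilon> n k) (complex_of_real (6 / pi\<^sup>2 *
                  (\<Sum>\<Lambda>\<in>int_partitions k.
                     eps2 \<Lambda> (listing \<Lambda>) /
                     (real (G_part \<Lambda>) *
                      (\<Prod>p\<in>prime_factors (L_part \<Lambda> div G_part \<Lambda>). (real p + 1))))))"
    (is "has_mean_value _ ?m")
proof -
  have "has_mean_value (\<lambda>n. \<Sum>\<Lambda>\<in>int_partitions k. of_int (partition_term \<epsilon> n \<Lambda>) :: complex)
      (\<Sum>\<Lambda>\<in>int_partitions k. of_real (6 / pi\<^sup>2 * (eps2 \<Lambda> (listing \<Lambda>) / (real (G_part \<Lambda>) *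
        (\<Prod>p\<in>prime_factors (L_part \<Lambda> div G_part \<Lambda>). real p + 1)))))"
  proof (rule has_mean_value_sum)
    fix \<Lambda> assume \<Lambda>: "\<Lambda> \<in> int_partitions k"
    then interpret positive_partition \<Lambda>
      using assms(2) by unfold_locales (auto simp: int_partitions_def)
    show "has_mean_value (\<lambda>n. of_int (partition_term \<epsilon> n \<Lambda>) :: complex)
     (of_real (6 / pi\<^sup>2 * (eps2 \<Lambda> (listing \<Lambda>) / (real (G_part \<Lambda>) *
        (\<Prod>p\<in>prime_factors (L_part \<Lambda> div G_part \<Lambda>). real p + 1)))))"
      using assms(1) assms(3)[OF \<Lambda>] by (rule has_mean_value_partition_term)
  qed
  also have "(\<Sum>\<Lambda>\<in>int_partitions k. complex_of_real (6 / pi\<^sup>2 * (eps2 \<Lambda> (listing \<Lambda>) / (real (G_part \<Lambda>) *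
        (\<Prod>p\<in>prime_factors (L_part \<Lambda> div G_part \<Lambda>). real p + 1))))) = ?m"
    unfolding sum_distrib_left of_real_sum ..
  finally show ?thesis
    by (rule has_mean_value_cong[where K = 1]) (simp add: cyclo_a_eps_eq_partition_sum[OF assms(1)])
qed

text \<open>For \<open>n > 1\<close> the coefficients of \<open>\<Phi>\<^sub>n\<close> and \<open>1 / \<Phi>\<^sub>n\<close> are the two cases of \<open>cyclo_a_eps\<close>; at
  \<open>n = 1\<close> they differ from these by a sign, which does not influence a mean value.\<close>

theorem theorem3:
  fixes \<epsilon> :: int and k :: nat and listing :: "nat multiset \<Rightarrow> nat list"
  assumes "\<epsilon> \<in> {-1, 1}"
    and "k \<ge> 1"
    and "\<And>\<Lambda>. \<Lambda> \<in> int_partitions k \<Longrightarrow> parts_listing \<Lambda> (listing \<Lambda>)"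
  shows "let m = complex_of_real (6 / pi\<^sup>2 *
                  (\<Sum>\<Lambda>\<in>int_partitions k.
                     eps2 \<Lambda> (listing \<Lambda>) /
                     (real (G_part \<Lambda>) *
                      (\<Prod>p\<in>prime_factors (L_part \<Lambda> div G_part \<Lambda>). (real p + 1)))))
         in has_mean_value (\<lambda>n. cyclo_a_eps \<epsilon> n k) m
          \<and> has_mean_value (\<lambda>n. cyclo_alpha n k) m
          \<and> has_mean_value (\<lambda>n. cyclo_a n k) m
          \<and> has_mean_value (\<lambda>n. cyclo_c n k) m
          \<and> has_mean_value (\<lambda>n. cyclo_beta n k) 0"
proof -
  define m where "m = complex_of_real (6 / pi\<^sup>2 *
                  (\<Sum>\<Lambda>\<in>int_partitions k.
                     eps2 \<Lambda> (listing \<Lambda>) /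
                     (real (G_part \<Lambda>) *
                      (\<Prod>p\<in>prime_factors (L_part \<Lambda> div G_part \<Lambda>). (real p + 1)))))"
  have mean: "has_mean_value (\<lambda>n. cyclo_a_eps \<delta> n k) m" if "\<delta> \<in> {-1, 1}" for \<delta>
    unfolding m_def using that assms(2,3) by (rule has_mean_value_cyclo_a_eps)
  have plus: "has_mean_value (\<lambda>n. cyclo_a_eps 1 n k) m"
    and minus: "has_mean_value (\<lambda>n. cyclo_a_eps (-1) n k) m"
    by (simp_all add: mean)
  have "has_mean_value (\<lambda>n. cyclo_alpha n k) m"
    using has_mean_value_cmult[OF has_mean_value_add[OF plus minus], of "1 / 2"]
    by (simp add: cyclo_alpha_def)
  moreover have "has_mean_value (\<lambda>n. cyclo_beta n k) 0"
    using has_mean_value_cmult[OF has_mean_value_diff[OF plus minus], of "1 / 2"]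
    by (simp add: cyclo_beta_def)
  moreover have "has_mean_value (\<lambda>n. cyclo_a n k) m"
    using plus by (rule has_mean_value_cong[where K = 2]) (simp add: cyclo_a_eq_cyclo_a_eps)
  moreover have "has_mean_value (\<lambda>n. cyclo_c n k) m"
    using minus by (rule has_mean_value_cong[where K = 2]) (simp add: cyclo_c_eq_cyclo_a_eps)
  ultimately show ?thesis
    using mean[OF assms(1)] unfolding Let_def m_def [symmetric] by blast
qed

end
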